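(* Let $m,n\ge1$, let $\mathfrak{g}=\mathbb{R}^m\ltimes_{d\phi}\mathbb{R}^n$ be a unimodular meta-abelian Lie algebra, and let $(\mathfrak{g},J,\langle\cdot,\cdot\rangle)$ be a non-Vaisman LCK structure with nonzero Lee form. If $\mathbb{R}^n+J\mathbb{R}^n=\mathfrak{g}$, then $\mathfrak{g}$ is an LCK OT-like Lie algebra of type $(s,t)$, where $m=s$ and $n=s+2t$.
   Context: Meta-abelian Lie algebras. For a linear map $d\phi:\mathbb{R}^m\to\mathrm{End}(\mathbb{R}^n)$ with pairwise commuting values, $\mathbb{R}^m\ltimes_{d\phi}\mathbb{R}^n$ is the real Lie algebra on $\mathbb{R}^m\times\mathbb{R}^n$ with bracket $[(X_1,Y_1),(X_2,Y_2)]=(0,\,d\phi(X_1)Y_2-d\phi(X_2)Y_1)$. A Lie algebra is unimodular if $\mathrm{tr}(\mathrm{ad}_X)=0$ for all $X$. LCK structures. An LCK structure $(\mathfrak{g},J,\langle\cdot,\cdot\rangle)$ on a real Lie algebra $\mathfrak{g}$ consists of $J\in\mathrm{End}(\mathfrak{g})$ with $J^2=-\mathrm{id}$ that is integrable, i.e. $[X,Y]-[JX,JY]+J[X,JY]+J[JX,Y]=0$ for all $X,Y$, and an inner product with $\langle J\cdot,J\cdot\rangle=\langle\cdot,\cdot\rangle$, such that for the fundamental form $\omega(X,Y)=\langle JX,Y\rangle$ there is $\theta\in\mathfrak{g}^*$ (the Lee form) with $\theta|_{[\mathfrak{g},\mathfrak{g}]}=0$ and $d\omega=\theta\wedge\omega$,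 i.e. $$-\omega([X,Y],Z)-\omega([Y,Z],X)-\omega([Z,X],Y)=\theta(X)\omega(Y,Z)+\theta(Y)\omega(Z,X)+\theta(Z)\omega(X,Y)$$ for all $X,Y,Z$. The Lee vector $A\in\mathfrak{g}$ is defined by $\theta=\langle A,\cdot\rangle$. The structure is Vaisman if $\mathrm{ad}_A$ is skew-symmetric with respect to $\langle\cdot,\cdot\rangle$. LCK OT-like Lie algebras. For $C=(c_{ij})\in\mathrm{Mat}_{t\times s}(\mathbb{C})$ with $\mathrm{Re}\,c_{ij}=-\tfrac1{2t}$ for all $1\le i\le t$, $1\le j\le s$, let $\mathfrak{g}_C=\mathbb{R}^s\ltimes_{d\phi_C}(\mathbb{R}^s\oplus\mathbb{C}^t)$ with $d\phi_C(t_1,\dots,t_s)=\mathrm{diag}(t_1,\dots,t_s,(\sum_{j=1}^s c_{ij}t_j)_{i=1}^t)$ (a real Lie algebra of dimension $2s+2t$, $s,t\ge1$). A Lie algebra is LCK OT-like of type $(s,t)$ if it is isomorphic to $\mathfrak{g}_C$ for some such $C$. *)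

theory Defs
  imports "HOL-Analysis.Analysis" "HOL-Library.Function_Algebras"
begin

(* Pointwise real vector space structure on functions.  It is needed because the numbers s and t
   occur existentially, so that R^s and C^t must be subspaces of a fixed type. *)
instantiation "fun" :: (type, real_vector) real_vector
begin

definition scaleR_fun :: "real \<Rightarrow> ('a \<Rightarrow> 'b) \<Rightarrow> 'a \<Rightarrow> 'b"
  where "scaleR_fun r f = (\<lambda>x. r *\<^sub>R f x)"

instance
  by standard (simp_all add: scaleR_fun_def fun_eq_iff scaleR_add_right scaleR_add_left)

end


definition lie_algebra_on :: "'g::real_vector set \<Rightarrow> ('g \<Rightarrow> 'g \<Rightarrow> 'g) \<Rightarrow> bool"
  where "lie_algebra_on V br \<longleftrightarrow>
    subspace V \<and> bilinear br \<and>
    (\<forall>X\<in>V. \<forall>Y\<in>V. br X Y \<in> V) \<and>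
    (\<forall>X\<in>V. br X X = 0) \<and>
    (\<forall>X\<in>V. \<forall>Y\<in>V. \<forall>Z\<in>V. br X (br Y Z) + br Y (br Z X) + br Z (br X Y) = 0)"

(* A linear map between subspaces extends to the ambient types, so f may be taken linear on all
   of the type 'g; only its restriction to V matters. *)
definition lie_isomorphic_on ::
    "'g::real_vector set \<Rightarrow> ('g \<Rightarrow> 'g \<Rightarrow> 'g) \<Rightarrow> 'h::real_vector set \<Rightarrow> ('h \<Rightarrow> 'h \<Rightarrow> 'h) \<Rightarrow> bool"
  where "lie_isomorphic_on V br W br' \<longleftrightarrow>
    (\<exists>f. linear f \<and> bij_betw f V W \<and> (\<forall>X\<in>V. \<forall>Y\<in>V. f (br X Y) = br' (f X) (f Y)))"

(* Basis is orthonormal, so this is the trace of a linear endomorphism f. *)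
definition endo_trace :: "('g::euclidean_space \<Rightarrow> 'g) \<Rightarrow> real"
  where "endo_trace f = (\<Sum>b\<in>Basis. f b \<bullet> b)"

definition unimodular :: "('g::euclidean_space \<Rightarrow> 'g \<Rightarrow> 'g) \<Rightarrow> bool"
  where "unimodular br \<longleftrightarrow> (\<forall>X. endo_trace (br X) = 0)"


(* A linear map from 'a to End('b) is a curried bilinear map. *)
definition commuting_rep :: "('a::real_vector \<Rightarrow> 'b::real_vector \<Rightarrow> 'b) \<Rightarrow> bool"
  where "commuting_rep \<phi> \<longleftrightarrow> bilinear \<phi> \<and> (\<forall>X X'. \<phi> X \<circ> \<phi> X' = \<phi> X' \<circ> \<phi> X)"

definition meta_bracket ::
    "('a::real_vector \<Rightarrow> 'b::real_vector \<Rightarrow> 'b) \<Rightarrow> 'a \<times> 'b \<Rightarrow> 'a \<times> 'b \<Rightarrow> 'a \<times> 'b"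
  where "meta_bracket \<phi> P Q = (0, \<phi> (fst P) (snd Q) - \<phi> (fst Q) (snd P))"

lemma bilinear_meta_bracket:
  assumes "bilinear \<phi>"
  shows "bilinear (meta_bracket \<phi>)"
  unfolding bilinear_def meta_bracket_def
  by (auto intro!: linearI simp: assms bilinear_ladd bilinear_radd bilinear_lmul bilinear_rmul
      algebra_simps)

lemma lie_algebra_meta_bracket:
  assumes "commuting_rep \<phi>"
  shows "lie_algebra_on UNIV (meta_bracket \<phi>)"
proof -
  have b: "bilinear \<phi>" and c: "\<And>X X' Y. \<phi> X (\<phi> X' Y) = \<phi> X' (\<phi> X Y)"
    using assms by (auto simp: commuting_rep_def fun_eq_iff)
  have "meta_bracket \<phi> X (meta_bracket \<phi> Y Z) + meta_bracket \<phi> Y (meta_bracket \<phi> Z X)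
      + meta_bracket \<phi> Z (meta_bracket \<phi> X Y) = 0" for X Y Z
    using c[of "fst X" "fst Y" "snd Z"] c[of "fst X" "fst Z" "snd Y"] c[of "fst Y" "fst Z" "snd X"]
    by (simp add: meta_bracket_def bilinear_rsub[OF b] bilinear_lzero[OF b] zero_prod_def)
  moreover have "meta_bracket \<phi> X X = 0" for X
    by (simp add: meta_bracket_def zero_prod_def)
  ultimately show ?thesis
    using bilinear_meta_bracket[OF b] by (simp add: lie_algebra_on_def)
qed


definition integrable_complex_structure ::
    "('g::real_vector \<Rightarrow> 'g \<Rightarrow> 'g) \<Rightarrow> ('g \<Rightarrow> 'g) \<Rightarrow> bool"
  where "integrable_complex_structure br J \<longleftrightarrow>
    linear J \<and> (\<forall>X. J (J X) = - X) \<and>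
    (\<forall>X Y. br X Y - br (J X) (J Y) + J (br X (J Y)) + J (br (J X) Y) = 0)"

definition inner_product :: "('g::real_vector \<Rightarrow> 'g \<Rightarrow> real) \<Rightarrow> bool"
  where "inner_product ip \<longleftrightarrow>
    bilinear ip \<and> (\<forall>X Y. ip X Y = ip Y X) \<and> (\<forall>X. X \<noteq> 0 \<longrightarrow> ip X X > 0)"

definition fundamental_form :: "('g \<Rightarrow> 'g) \<Rightarrow> ('g \<Rightarrow> 'g \<Rightarrow> real) \<Rightarrow> 'g \<Rightarrow> 'g \<Rightarrow> real"
  where "fundamental_form J ip X Y = ip (J X) Y"

definition is_lee_form ::
    "('g::real_vector \<Rightarrow> 'g \<Rightarrow> 'g) \<Rightarrow> ('g \<Rightarrow> 'g) \<Rightarrow> ('g \<Rightarrow> 'g \<Rightarrow> real) \<Rightarrow> ('g \<Rightarrow> real) \<Rightarrow> bool"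
  where "is_lee_form br J ip \<theta> \<longleftrightarrow>
    linear \<theta> \<and> (\<forall>X Y. \<theta> (br X Y) = 0) \<and>
    (let \<omega> = fundamental_form J ip in
      \<forall>X Y Z. - \<omega> (br X Y) Z - \<omega> (br Y Z) X - \<omega> (br Z X) Y
        = \<theta> X * \<omega> Y Z + \<theta> Y * \<omega> Z X + \<theta> Z * \<omega> X Y)"

(* The Lee form is an argument: it is determined by the remaining data from real dimension 4 on,
   but in dimension 2 every closed 1-form satisfies the defining condition. *)
definition lck_structure ::
    "('g::real_vector \<Rightarrow> 'g \<Rightarrow> 'g) \<Rightarrow> ('g \<Rightarrow> 'g) \<Rightarrow> ('g \<Rightarrow> 'g \<Rightarrow> real) \<Rightarrow> ('g \<Rightarrow> real) \<Rightarrow> bool"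
  where "lck_structure br J ip \<theta> \<longleftrightarrow>
    integrable_complex_structure br J \<and>
    inner_product ip \<and> (\<forall>X Y. ip (J X) (J Y) = ip X Y) \<and>
    is_lee_form br J ip \<theta>"

definition lee_vector :: "('g::real_vector \<Rightarrow> 'g \<Rightarrow> real) \<Rightarrow> ('g \<Rightarrow> real) \<Rightarrow> 'g"
  where "lee_vector ip \<theta> = (THE A. \<forall>X. \<theta> X = ip A X)"

definition vaisman ::
    "('g::real_vector \<Rightarrow> 'g \<Rightarrow> 'g) \<Rightarrow> ('g \<Rightarrow> 'g) \<Rightarrow> ('g \<Rightarrow> 'g \<Rightarrow> real) \<Rightarrow> ('g \<Rightarrow> real) \<Rightarrow> bool"
  where "vaisman br J ip \<theta> \<longleftrightarrow>
    lck_structure br J ip \<theta> \<and>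
    (let A = lee_vector ip \<theta> in \<forall>X Y. ip (br A X) Y = - ip X (br A Y))"


(* R^s and C^t are the functions on the naturals that vanish from the index s resp. t on; indices
   are shifted to start at 0. *)
definition ot_carrier ::
    "nat \<Rightarrow> nat \<Rightarrow> ((nat \<Rightarrow> real) \<times> (nat \<Rightarrow> real) \<times> (nat \<Rightarrow> complex)) set"
  where "ot_carrier s t =
    {(a, b, z). (\<forall>j\<ge>s. a j = 0) \<and> (\<forall>j\<ge>s. b j = 0) \<and> (\<forall>i\<ge>t. z i = 0)}"

definition ot_rep ::
    "nat \<Rightarrow> (nat \<Rightarrow> nat \<Rightarrow> complex) \<Rightarrow> (nat \<Rightarrow> real) \<Rightarrow>
      (nat \<Rightarrow> real) \<times> (nat \<Rightarrow> complex) \<Rightarrow> (nat \<Rightarrow> real) \<times> (nat \<Rightarrow> complex)"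
  where "ot_rep s C a = (\<lambda>(b, z).
    (\<lambda>j. a j * b j, \<lambda>i. (\<Sum>j<s. C i j * complex_of_real (a j)) * z i))"

definition ot_bracket ::
    "nat \<Rightarrow> (nat \<Rightarrow> nat \<Rightarrow> complex) \<Rightarrow>
      (nat \<Rightarrow> real) \<times> (nat \<Rightarrow> real) \<times> (nat \<Rightarrow> complex) \<Rightarrow>
      (nat \<Rightarrow> real) \<times> (nat \<Rightarrow> real) \<times> (nat \<Rightarrow> complex) \<Rightarrow>
      (nat \<Rightarrow> real) \<times> (nat \<Rightarrow> real) \<times> (nat \<Rightarrow> complex)"
  where "ot_bracket s C = meta_bracket (ot_rep s C)"

definition lck_ot_like :: "nat \<Rightarrow> nat \<Rightarrow> ('g::real_vector \<Rightarrow> 'g \<Rightarrow> 'g) \<Rightarrow> bool"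
  where "lck_ot_like s t br \<longleftrightarrow>
    s \<ge> 1 \<and> t \<ge> 1 \<and>
    (\<exists>C. (\<forall>i<t. \<forall>j<s. Re (C i j) = - 1 / (2 * real t)) \<and>
      lie_isomorphic_on UNIV br (ot_carrier s t) (ot_bracket s C))"

lemma commuting_rep_ot_rep: "commuting_rep (ot_rep s C)"
proof -
  have "bilinear (ot_rep s C)"
    unfolding bilinear_def
    by (auto intro!: linearI simp: ot_rep_def fun_eq_iff scaleR_fun_def algebra_simps
        sum.distrib sum_distrib_left scaleR_conv_of_real)
  moreover have "ot_rep s C X \<circ> ot_rep s C X' = ot_rep s C X' \<circ> ot_rep s C X" for X X'
    by (auto simp: ot_rep_def fun_eq_iff mult.left_commute)
  ultimately show ?thesis by (simp add: commuting_rep_def)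
qed

lemma lie_algebra_ot: "lie_algebra_on (ot_carrier s t) (ot_bracket s C)"
proof -
  have "subspace (ot_carrier s t)"
    by (auto simp: subspace_def ot_carrier_def zero_prod_def scaleR_fun_def)
  moreover have "ot_bracket s C X Y \<in> ot_carrier s t"
    if "X \<in> ot_carrier s t" "Y \<in> ot_carrier s t" for X Y
    using that by (auto simp: ot_carrier_def ot_bracket_def meta_bracket_def ot_rep_def)
  ultimately show ?thesis
    using lie_algebra_meta_bracket[OF commuting_rep_ot_rep[of s C]]
    unfolding lie_algebra_on_def ot_bracket_def by blast
qed

end

theory Submission
  imports Defs
begin

text \<open>
Write \<open>V\<close> for the abelian ideal, \<open>W = V \<inter> JV\<close> and \<open>U\<close> for the orthogonal complement of \<open>W\<close> in
\<open>V\<close>, so that \<open>\<gg> = JU \<oplus> U \<oplus> W\<close>. Integrability makes \<open>JU\<close> act complex linearly on \<open>W\<close>, and the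
LCK condition makes \<open>ad (Ju)\<close> equal to \<open>-\<theta>(Ju)/2\<close> plus a skew operator there. If \<open>\<theta>\<close> did not vanish
on \<open>W\<close>, the Lee vector would be central and the structure Vaisman. Hence \<open>u \<cdot> v = [Ju, v]\<close> is a
commutative associative product on \<open>U\<close>.

If \<open>W = 0\<close>, unimodularity says that all multiplications are traceless, so the algebra has no
nonzero idempotent; an element \<open>z \<noteq> 0\<close> annihilated by \<open>U\<close> exists, and the Lee vector is a
combination of the central elements \<open>z\<close> and \<open>Jz\<close>, which again is the Vaisman case.

If \<open>W \<noteq> 0\<close>, then \<open>\<theta>\<close> vanishes on \<open>V\<close>. Let \<open>h\<close> represent \<open>\<lambda>(u) = \<theta>(Ju)\<close> on \<open>U\<close>. Multiplication by
\<open>h\<close> is a scalar \<open>\<mu>\<close>, positive by unimodularity, and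
\<open>\<lambda>(u \<cdot> v) = (\<mu> + |h|\<^sup>2) \<langle>u, v\<rangle> - \<lambda>(u) \<lambda>(v)\<close>
is positive definite by the Cauchy-Schwarz inequality. All multiplications are symmetric for this form, so
their common eigenvectors give a basis of orthogonal idempotents of \<open>U\<close>; unimodularity fixes the
value of \<open>\<lambda>\<close> on them, and diagonalising the action on \<open>W\<close> gives the matrix \<open>C\<close>.
\<close>

section \<open>Simultaneous diagonalisation of commuting symmetric operators\<close>

text \<open>Bilinearity is global, but symmetry and positivity are relative to \<open>S\<close>: the
  form \<open>lam (act u v)\<close> used later is shown to be an inner product on \<open>U\<close>
  only.\<close>

definition form_on :: "'a::euclidean_space set \<Rightarrow> ('a \<Rightarrow> 'a \<Rightarrow> real) \<Rightarrow> bool"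
  where "form_on S T \<longleftrightarrow> bilinear T \<and> (\<forall>x\<in>S. \<forall>y\<in>S. T x y = T y x) \<and> (\<forall>x\<in>S. x \<noteq> 0 \<longrightarrow> T x x > 0)"

lemma form_on_subset: "form_on S T \<Longrightarrow> S' \<subseteq> S \<Longrightarrow> form_on S' T"
  unfolding form_on_def by blast

lemma form_onD:
  assumes "form_on S T"
  shows "bilinear T" "x \<in> S \<Longrightarrow> y \<in> S \<Longrightarrow> T x y = T y x" "x \<in> S \<Longrightarrow> x \<noteq> 0 \<Longrightarrow> T x x > 0"
  using assms unfolding form_on_def by blast+

lemma bilinear_linear: "bilinear T \<Longrightarrow> linear (T x)" "bilinear T \<Longrightarrow> linear (\<lambda>x. T x y)"
  unfolding bilinear_def by auto

lemma form_kernel: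
  assumes T: "form_on S T" and x: "x \<in> S" and 0: "T x x = 0"
  shows "x = 0"
  using form_onD(3)[OF T x] 0 by force

text \<open>Rayleigh quotient: the quotient of \<open>T (L x) x\<close> by \<open>T x x\<close>
  attains its maximum on the compact Euclidean unit sphere of \<open>S\<close>, and a maximiser is
  an eigenvector.\<close>

lemma symmetric_eigenvector:
  fixes T :: "'a::euclidean_space \<Rightarrow> 'a \<Rightarrow> real"
  assumes T: "form_on S T" and S: "subspace S" "S \<noteq> {0}"
    and L: "linear L" "\<And>x. x \<in> S \<Longrightarrow> L x \<in> S"
    and sym: "\<And>x y. x \<in> S \<Longrightarrow> y \<in> S \<Longrightarrow> T (L x) y = T x (L y)"
  obtains x c where "x \<in> S" "x \<noteq> 0" "L x = c *\<^sub>R x"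
proof -
  note bil = form_onD(1)[OF T]
  have bb: "bounded_bilinear T"
    using bil by (simp add: bilinear_conv_bounded_bilinear)
  let ?K = "S \<inter> sphere 0 1"
  have K: "compact ?K"
    using closed_subspace[OF S(1)] by (simp add: closed_Int_compact)
  obtain v where v: "v \<in> S" "v \<noteq> 0"
    using S subspace_0 by fastforce
  then have "(1 / norm v) *\<^sub>R v \<in> ?K"
    using S(1) by (auto simp: subspace_scale)
  then have ne: "?K \<noteq> {}" by blast
  have pos: "T x x > 0" if "x \<in> ?K" for x
    using that form_onD(3)[OF T] by force
  have cL: "continuous_on ?K L"
    using L(1) linear_continuous_on linear_linear by blast
  have "continuous_on ?K (\<lambda>x. T (L x) x / T x x)"
    using pos by (intro continuous_intros bounded_bilinear.continuous_on[OF bb] cL) force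
  then obtain x where x: "x \<in> ?K" and mx: "\<And>y. y \<in> ?K \<Longrightarrow> T (L y) y / T y y \<le> T (L x) x / T x x"
    using continuous_attains_sup[OF K ne] by blast
  define c where "c = T (L x) x / T x x"
  have xS: "x \<in> S" and x0: "x \<noteq> 0" using x by auto
  have le: "T (L y) y \<le> c * T y y" if y: "y \<in> S" for y
  proof (cases "y = 0")
    case True
    then show ?thesis using bil by (simp add: bilinear_rzero)
  next
    case False
    let ?y = "(1 / norm y) *\<^sub>R y"
    have "?y \<in> ?K" using y False S(1) by (auto simp: subspace_scale)
    then have "T (L ?y) ?y / T ?y ?y \<le> c" using mx c_def by blast
    moreover have "T (L ?y) ?y / T ?y ?y = T (L y) y / T y y"
      using False by (simp add: linear_scale[OF L(1)] bilinear_lmul[OF bil] bilinear_rmul[OF bil])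
    ultimately show ?thesis
      using form_onD(3)[OF T y False] by (simp add: pos_divide_le_eq)
  qed
  \<comment> \<open>By maximality of \<open>c\<close> this form is positive semidefinite on
    \<open>S\<close>, and it vanishes on \<open>x\<close>. Hence \<open>x\<close> lies in its
    radical, which is the eigenvector equation.\<close>
  define q where "q = (\<lambda>x y. c * T x y - T (L x) y)"
  have qx: "q x x = 0" using pos[OF x] by (simp add: q_def c_def)
  have q0: "q x y = 0" if y: "y \<in> S" for y
  proof -
    have e: "0 \<le> 2 * r * q x y + r\<^sup>2 * q y y" for r
    proof -
      have "x + r *\<^sub>R y \<in> S" using xS y S(1) by (simp add: subspace_add subspace_scale)
      from le[OF this] have "0 \<le> q (x + r *\<^sub>R y) (x + r *\<^sub>R y)" by (simp add: q_def)
      also have "\<dots> = q x x + 2 * r * q x y + r\<^sup>2 * q y y"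
        using sym[OF xS y] form_onD(2)[OF T xS y] form_onD(2)[OF T xS L(2)[OF y]]
        by (simp add: q_def linear_add[OF L(1)] linear_scale[OF L(1)] bilinear_ladd[OF bil]
            bilinear_radd[OF bil] bilinear_lmul[OF bil] bilinear_rmul[OF bil] algebra_simps
            power2_eq_square)
      finally show ?thesis using qx by simp
    qed
    show ?thesis
    proof (rule ccontr)
      assume n: "q x y \<noteq> 0"
      have qy: "q y y \<ge> 0" using le[OF y] by (simp add: q_def)
      \<comment> \<open>A parameter at which the quadratic polynomial in \<open>r\<close> is
        negative; the summand 1 keeps the denominator positive when \<open>q y y\<close> is
        0.\<close>
      let ?r = "- q x y / (1 + q y y)"
      have "2 * ?r * q x y + ?r\<^sup>2 * q y y = - (q x y)\<^sup>2 * (2 + q y y) / (1 + q y y)\<^sup>2"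
        using qy by (simp add: power2_eq_square divide_simps) (simp add: algebra_simps)
      also have "\<dots> < 0" using n qy by (simp add: divide_neg_pos mult_neg_pos)
      finally show False using e[of ?r] by simp
    qed
  qed
  let ?d = "L x - c *\<^sub>R x"
  have d: "?d \<in> S" using xS L(2) S(1) by (simp add: subspace_diff subspace_scale)
  have "T ?d ?d = 0"
    using q0[OF d] by (simp add: q_def bilinear_lsub[OF bil] bilinear_lmul[OF bil])
  then have "?d = 0" by (rule form_kernel[OF T d])
  then show thesis using that xS x0 by simp
qed

definition symmetric_family :: "'a::euclidean_space set \<Rightarrow> ('a \<Rightarrow> 'a \<Rightarrow> real) \<Rightarrow> ('a \<Rightarrow> 'a) set \<Rightarrow> bool"
  where "symmetric_family S T F \<longleftrightarrow>
    (\<forall>L\<in>F. linear L \<and> (\<forall>x\<in>S. L x \<in> S) \<and> (\<forall>x\<in>S. \<forall>y\<in>S. T (L x) y = T x (L y))) \<and>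
    (\<forall>L\<in>F. \<forall>L'\<in>F. \<forall>x\<in>S. L (L' x) = L' (L x))"

lemma symmetric_familyD:
  assumes "symmetric_family S T F" "L \<in> F"
  shows "linear L" "x \<in> S \<Longrightarrow> L x \<in> S" "x \<in> S \<Longrightarrow> y \<in> S \<Longrightarrow> T (L x) y = T x (L y)"
    "L' \<in> F \<Longrightarrow> x \<in> S \<Longrightarrow> L (L' x) = L' (L x)"
  using assms unfolding symmetric_family_def by blast+

lemma symmetric_family_subset:
  assumes "symmetric_family S T F" "S' \<subseteq> S" "\<And>L x. L \<in> F \<Longrightarrow> x \<in> S' \<Longrightarrow> L x \<in> S'"
  shows "symmetric_family S' T F"
  using assms unfolding symmetric_family_def by (meson subsetD)

text \<open>If some \<open>L\<close> in the family is not a scalar on \<open>S\<close>, one of its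
  eigenspaces is a proper nonzero subspace, and commutation makes it invariant under the family;
  induct on the dimension.\<close>

lemma common_eigenvector:
  fixes T :: "'a::euclidean_space \<Rightarrow> 'a \<Rightarrow> real"
  assumes "form_on S T" "subspace S" "S \<noteq> {0}" "symmetric_family S T F"
  shows "\<exists>x\<in>S. x \<noteq> 0 \<and> (\<forall>L\<in>F. \<exists>c. L x = c *\<^sub>R x)"
  using assms
proof (induction "dim S" arbitrary: S rule: less_induct)
  case less
  show ?case
  proof (cases "\<forall>L\<in>F. \<exists>c. \<forall>x\<in>S. L x = c *\<^sub>R x")
    case True
    obtain x where "x \<in> S" "x \<noteq> 0" using less.prems subspace_0 by fastforce
    then show ?thesis using True by blast
  next
    case False
    then obtain L where L: "L \<in> F" and nsc: "\<And>c. \<exists>x\<in>S. L x \<noteq> c *\<^sub>R x" by blast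
    note LD = symmetric_familyD[OF less.prems(4) L]
    obtain x c where x: "x \<in> S" "x \<noteq> 0" "L x = c *\<^sub>R x"
      using symmetric_eigenvector[OF less.prems(1-3) LD(1-3)] by blast
    define E where "E = {y\<in>S. L y = c *\<^sub>R y}"
    have E: "subspace E" using less.prems(2) LD(1)
      by (auto simp: E_def subspace_def linear_0 linear_add linear_scale algebra_simps)
    have sub: "E \<subseteq> S" "E \<noteq> S" using nsc[of c] by (auto simp: E_def)
    then have "dim E < dim S"
      using E less.prems(2) by (metis dim_subset le_neq_implies_less subspace_dim_equal order_refl)
    moreover have "E \<noteq> {0}" using x by (auto simp: E_def)
    moreover have "symmetric_family E T F"
    proof (rule symmetric_family_subset[OF less.prems(4) sub(1)])
      fix L' y assume L': "L' \<in> F" and y: "y \<in> E"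
      note L'D = symmetric_familyD[OF less.prems(4) L']
      show "L' y \<in> E"
        using y L'D(2) LD(4)[OF L'] linear_scale[OF L'D(1)] by (auto simp: E_def)
    qed
    ultimately show ?thesis
      using less.hyps[of E] E form_on_subset[OF less.prems(1) sub(1)] sub(1) by blast
  qed
qed

definition orthogonal_for :: "('a \<Rightarrow> 'a \<Rightarrow> real) \<Rightarrow> 'a set \<Rightarrow> bool"
  where "orthogonal_for T B \<longleftrightarrow> pairwise (\<lambda>x y. T x y = 0) B"

text \<open>Subtracting from a vector its \<open>T\<close>-projection onto \<open>x\<close> leaves a
  vector of the complement.\<close>

lemma span_complement_insert:
  fixes T :: "'a::euclidean_space \<Rightarrow> 'a \<Rightarrow> real"
  assumes T: "bilinear T" and S: "subspace S" and x: "x \<in> S" and n: "T x x \<noteq> 0"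
    and B: "span B = {y\<in>S. T y x = 0}"
  shows "span (insert x B) = S"
proof
  have "B \<subseteq> S" using span_superset[of B] B by blast
  then show "span (insert x B) \<subseteq> S" using x S by (simp add: span_minimal)
  show "S \<subseteq> span (insert x B)"
  proof
    fix y assume y: "y \<in> S"
    have "y - (T y x / T x x) *\<^sub>R x \<in> span B"
      using y x S n by (simp add: B subspace_diff subspace_scale bilinear_lsub[OF T] bilinear_lmul[OF T])
    then show "y \<in> span (insert x B)" using span_insert by blast
  qed
qed

lemma subspace_form_complement:
  assumes "bilinear T" "subspace S"
  shows "subspace {y\<in>S. T y x = 0}"
  using assms by (auto simp: subspace_def bilinear_lzero bilinear_ladd bilinear_lmul)

lemma dim_proper_subspace:
  fixes S :: "'a::euclidean_space set"
  assumes "subspace S" "subspace S'" "S' \<subseteq> S" "x \<in> S" "x \<notin> S'"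
  shows "dim S' < dim S"
  using assms by (metis dim_subset le_neq_implies_less subspace_dim_equal order_refl)

text \<open>Split off a common eigenvector; by symmetry its \<open>T\<close>-complement is again
  invariant under the family.\<close>

lemma orthogonal_eigenbasis:
  fixes T :: "'a::euclidean_space \<Rightarrow> 'a \<Rightarrow> real"
  assumes "form_on S T" "subspace S" "symmetric_family S T F"
  shows "\<exists>B. finite B \<and> 0 \<notin> B \<and> orthogonal_for T B \<and> span B = S \<and> (\<forall>b\<in>B. \<forall>L\<in>F. \<exists>c. L b = c *\<^sub>R b)"
  using assms
proof (induction "dim S" arbitrary: S rule: less_induct)
  case less
  note T = less.prems(1) and S = less.prems(2) and F = less.prems(3)
  note bil = form_onD(1)[OF T]
  show ?case
  proof (cases "S = {0}")
    case True
    then show ?thesis by (intro exI[of _ "{}"]) (auto simp: orthogonal_for_def)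
  next
    case False
    then obtain x where x: "x \<in> S" "x \<noteq> 0" and ev: "\<forall>L\<in>F. \<exists>c. L x = c *\<^sub>R x"
      using common_eigenvector[OF T S _ F] by blast
    define S' where "S' = {y\<in>S. T y x = 0}"
    have xx: "T x x > 0" using form_onD(3)[OF T] x by blast
    have S': "subspace S'" "S' \<subseteq> S" "x \<notin> S'"
      using subspace_form_complement[OF bil S] xx by (auto simp: S'_def)
    have F': "symmetric_family S' T F"
    proof (rule symmetric_family_subset[OF F S'(2)])
      fix L y assume L: "L \<in> F" and y: "y \<in> S'"
      obtain c where "L x = c *\<^sub>R x" using ev L by blast
      then show "L y \<in> S'"
        using y x symmetric_familyD[OF F L] by (simp add: S'_def bilinear_rmul[OF bil])
    qed
    have "dim S' < dim S" using dim_proper_subspace[OF S S'(1,2) x(1) S'(3)] .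
    from less.hyps[OF this form_on_subset[OF T S'(2)] S'(1) F'] obtain B where
      B: "finite B" "0 \<notin> B" "orthogonal_for T B" "span B = S'"
        "\<forall>b\<in>B. \<forall>L\<in>F. \<exists>c. L b = c *\<^sub>R b" by blast
    have BS: "b \<in> S \<and> T b x = 0 \<and> T x b = 0" if "b \<in> B" for b
    proof -
      have "b \<in> S'" using that B(4) span_base by blast
      then show ?thesis using form_onD(2)[OF T x(1), of b] by (auto simp: S'_def)
    qed
    have "orthogonal_for T (insert x B)"
      using B(3) BS by (auto simp: orthogonal_for_def pairwise_insert)
    moreover have "span (insert x B) = S"
      using span_complement_insert[OF bil S x(1)] xx B(4) by (simp add: S'_def)
    ultimately show ?thesis using B x ev by (intro exI[of _ "insert x B"]) auto
  qed
qed

lemma orthogonal_basis: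
  fixes T :: "'a::euclidean_space \<Rightarrow> 'a \<Rightarrow> real"
  assumes "form_on S T" "subspace S"
  obtains B where "finite B" "0 \<notin> B" "orthogonal_for T B" "span B = S"
  using orthogonal_eigenbasis[OF assms, of "{}"] by (auto simp: symmetric_family_def)

section \<open>Coordinates in orthogonal bases, Riesz vectors and traces\<close>

lemma orthogonal_coefficient:
  assumes T: "bilinear T" and f: "finite B" "orthogonal_for T B" "b \<in> B"
  shows "T (\<Sum>a\<in>B. c a *\<^sub>R a) b = c b * T b b"
proof -
  have "T (\<Sum>a\<in>B. c a *\<^sub>R a) b = (\<Sum>a\<in>B. c a * T a b)"
    by (simp add: linear_sum[OF bilinear_linear(2)[OF T]] bilinear_lmul[OF T])
  also have "\<dots> = (\<Sum>a\<in>B. if a = b then c b * T b b else 0)"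
    using f by (intro sum.cong) (auto simp: orthogonal_for_def pairwise_def)
  finally show ?thesis using f by simp
qed

lemma orthogonal_independent:
  assumes T: "form_on S T" and B: "finite B" "0 \<notin> B" "orthogonal_for T B" "B \<subseteq> S"
  shows "independent B"
proof
  assume "dependent B"
  then obtain c b where "b \<in> B" "c b \<noteq> 0" "(\<Sum>v\<in>B. c v *\<^sub>R v) = 0"
    using B(1) by (auto simp: dependent_finite)
  then have "c b * T b b = 0"
    using orthogonal_coefficient[OF form_onD(1)[OF T] B(1,3), of b c]
    by (simp add: bilinear_lzero[OF form_onD(1)[OF T]])
  moreover have "T b b > 0" using form_onD(3)[OF T] B \<open>b \<in> B\<close> by blast
  ultimately show False using \<open>c b \<noteq> 0\<close> by simp
qed

lemma orthogonal_representation: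
  assumes T: "form_on S T" and B: "finite B" "0 \<notin> B" "orthogonal_for T B" "span B = S"
    and b: "b \<in> B" and x: "x \<in> S"
  shows "representation B x b = T x b / T b b"
proof -
  have BS: "B \<subseteq> S" using B(4) span_superset by blast
  have ind: "independent B" using orthogonal_independent[OF T B(1-3) BS] .
  have "(\<Sum>a\<in>B. representation B x a *\<^sub>R a) = x"
    using sum_representation_eq[OF ind] x B by blast
  then have "T x b = representation B x b * T b b"
    using orthogonal_coefficient[OF form_onD(1)[OF T] B(1,3) b, of "representation B x"] by simp
  moreover have "T b b > 0" using form_onD(3)[OF T] b BS B(2) by blast
  ultimately show ?thesis by simp
qed

lemma riesz_representation:
  fixes T :: "'a::euclidean_space \<Rightarrow> 'a \<Rightarrow> real"
  assumes T: "form_on S T" and S: "subspace S" and l: "linear l"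
  obtains h where "h \<in> S" "\<And>x. x \<in> S \<Longrightarrow> l x = T h x"
proof -
  note bil = form_onD(1)[OF T]
  obtain B where B: "finite B" "0 \<notin> B" "orthogonal_for T B" "span B = S"
    using orthogonal_basis[OF T S] .
  have BS: "B \<subseteq> S" using B(4) span_superset by blast
  define h where "h = (\<Sum>b\<in>B. (l b / T b b) *\<^sub>R b)"
  have hS: "h \<in> S" unfolding h_def using BS S by (auto intro!: subspace_sum subspace_scale)
  have "l x = T h x" if "x \<in> span B" for x
  proof (rule linear_eq_on[OF l bilinear_linear(1)[OF bil] that])
    fix b assume b: "b \<in> B"
    then have "T b b > 0" using form_onD(3)[OF T] BS B(2) by blast
    then show "l b = T h b"
      using orthogonal_coefficient[OF bil B(1,3) b, of "\<lambda>b. l b / T b b"] by (simp add: h_def)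
  qed
  then show thesis using that hS B(4) by blast
qed

text \<open>\<open>B\<close> need only span a subspace containing the image of \<open>f\<close>.
  Expanding \<open>f i\<close> in \<open>B\<close> and exchanging the sums reassembles each
  \<open>b\<close> from its Euclidean coordinates.\<close>

lemma endo_trace_representation:
  fixes f :: "'a::euclidean_space \<Rightarrow> 'a"
  assumes f: "linear f" and B: "finite B" "independent B" "range f \<subseteq> span B"
  shows "endo_trace f = (\<Sum>b\<in>B. representation B (f b) b)"
proof -
  have lin: "linear (\<lambda>x. representation B (f x) b)" for b
  proof (rule linearI)
    show "representation B (f (x + y)) b = representation B (f x) b + representation B (f y) b" for x y
      using B by (simp add: linear_add[OF f] representation_add image_subset_iff)
    show "representation B (f (r *\<^sub>R x)) b = r *\<^sub>R representation B (f x) b" for r x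
      using B by (simp add: linear_scale[OF f] representation_scale image_subset_iff)
  qed
  have "endo_trace f = (\<Sum>i\<in>Basis. (\<Sum>b\<in>B. representation B (f i) b *\<^sub>R b) \<bullet> i)"
    unfolding endo_trace_def using B
    by (intro sum.cong refl arg_cong2[where f=inner] sum_representation_eq[symmetric])
      (auto simp: image_subset_iff)
  also have "\<dots> = (\<Sum>b\<in>B. \<Sum>i\<in>Basis. (b \<bullet> i) *\<^sub>R representation B (f i) b)"
    by (subst sum.swap) (simp add: inner_sum_left mult.commute)
  also have "\<dots> = (\<Sum>b\<in>B. representation B (f (\<Sum>i\<in>Basis. (b \<bullet> i) *\<^sub>R i)) b)"
    by (intro sum.cong refl) (simp only: linear_sum[OF lin] linear_scale[OF lin])
  finally show ?thesis by (simp add: euclidean_representation)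
qed

text \<open>In a basis of the image, which \<open>f\<close> fixes pointwise, every diagonal
  coefficient is 1.\<close>

lemma idempotent_endo_trace:
  fixes f :: "'a::euclidean_space \<Rightarrow> 'a"
  assumes f: "linear f" and id: "\<And>x. f (f x) = f x"
  shows "endo_trace f = dim (range f)"
proof -
  obtain B where B: "B \<subseteq> range f" "independent B" "range f \<subseteq> span B" "card B = dim (range f)"
    using basis_exists by blast
  have fin: "finite B" using B(2) independent_imp_finite by blast
  have "endo_trace f = (\<Sum>b\<in>B. representation B (f b) b)"
    using endo_trace_representation[OF f fin B(2,3)] .
  also have "\<dots> = (\<Sum>b\<in>B. 1)"
    using B(1,2) id by (intro sum.cong refl) (auto simp: representation_basis)
  finally show ?thesis using B(4) by simp
qed

lemma independent_union:
  fixes B C :: "'a::euclidean_space set"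
  assumes B: "independent B" and C: "independent C" and 0: "span B \<inter> span C \<subseteq> {0}"
  shows "independent (B \<union> C)" "B \<inter> C = {}"
proof -
  have fin: "finite B" "finite C" using B C independent_imp_finite by blast+
  have "0 \<notin> B" using B dependent_zero by blast
  then show disj: "B \<inter> C = {}" using 0 span_base by blast
  show "independent (B \<union> C)"
  proof
    assume "dependent (B \<union> C)"
    then obtain c x where c: "x \<in> B \<union> C" "c x \<noteq> 0" "(\<Sum>v\<in>B \<union> C. c v *\<^sub>R v) = 0"
      using fin by (auto simp: dependent_finite)
    let ?b = "\<Sum>v\<in>B. c v *\<^sub>R v" and ?c = "\<Sum>v\<in>C. c v *\<^sub>R v"
    have "?b + ?c = 0" using c(3) fin disj by (simp add: sum.union_disjoint)
    then have e: "?b = - ?c" by (simp add: eq_neg_iff_add_eq_0)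
    have sp: "?b \<in> span B" "?c \<in> span C"
      by (intro span_sum span_scale span_base; assumption)+
    then have "?b \<in> span C" unfolding e by (intro span_neg)
    then have "?b = 0" using sp(1) 0 by blast
    moreover have "?c = 0" using \<open>?b = 0\<close> e by simp
    ultimately show False
      using c(1,2) B C fin by (auto simp: dependent_finite)
  qed
qed

section \<open>Eigenbases over the complex numbers and inversion of isomorphisms\<close>

text \<open>As in the real case, but the complex line of \<open>x\<close> and \<open>j x\<close> is
  split off. Since the family commutes with \<open>j\<close>, both vectors have the same
  eigenvalues, and since \<open>j\<close> is \<open>T\<close>-orthogonal, the complement is
  \<open>j\<close>-invariant.\<close>

lemma orthogonal_complex_eigenbasis:
  fixes T :: "'a::euclidean_space \<Rightarrow> 'a \<Rightarrow> real"
  assumes "form_on S T" "subspace S" "symmetric_family S T F"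
    and j: "linear j" "\<And>x. j (j x) = - x" and jT: "\<And>x y. T (j x) (j y) = T x y"
    and "\<And>x. x \<in> S \<Longrightarrow> j x \<in> S" "\<And>L x. L \<in> F \<Longrightarrow> x \<in> S \<Longrightarrow> L (j x) = j (L x)"
  shows "\<exists>B. finite B \<and> 0 \<notin> B \<and> orthogonal_for T B \<and> (\<forall>b\<in>B. \<forall>b'\<in>B. T (j b) b' = 0) \<and>
    span (B \<union> j ` B) = S \<and> (\<forall>b\<in>B. \<forall>L\<in>F. \<exists>c. L b = c *\<^sub>R b)"
  using assms(1-3,7,8)
proof (induction "dim S" arbitrary: S rule: less_induct)
  case less
  note T = less.prems(1) and S = less.prems(2) and F = less.prems(3) and jS = less.prems(4)
    and jF = less.prems(5)
  note bil = form_onD(1)[OF T]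
  show ?case
  proof (cases "S = {0}")
    case True
    then show ?thesis by (intro exI[of _ "{}"]) (auto simp: orthogonal_for_def)
  next
    case False
    then obtain x where x: "x \<in> S" "x \<noteq> 0" and ev: "\<forall>L\<in>F. \<exists>c. L x = c *\<^sub>R x"
      using common_eigenvector[OF T S _ F] by blast
    \<comment> \<open>The complement is cut out in two stages so that \<open>x\<close> and
      \<open>j x\<close> can be put back one at a time.\<close>
    define S1 where "S1 = {y\<in>S. T y x = 0}"
    define S' where "S' = {y\<in>S1. T y (j x) = 0}"
    have xx: "T x x > 0" using form_onD(3)[OF T] x by blast
    have jx0: "T (j x) x = 0"
      using jT[of "j x" x] j(2)[of x] form_onD(2)[OF T x(1) jS[OF x(1)]]
      by (simp add: bilinear_lneg[OF bil])
    have jx: "j x \<in> S1" using jS x jx0 by (simp add: S1_def)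
    have S1: "subspace S1" unfolding S1_def by (rule subspace_form_complement[OF bil S])
    have S': "subspace S'" unfolding S'_def by (rule subspace_form_complement[OF bil S1])
    have sub: "S' \<subseteq> S" "x \<notin> S'" using xx by (auto simp: S'_def S1_def)
    have F': "symmetric_family S' T F"
    proof (rule symmetric_family_subset[OF F sub(1)])
      fix L y assume L: "L \<in> F" and y: "y \<in> S'"
      note LD = symmetric_familyD[OF F L]
      obtain c where c: "L x = c *\<^sub>R x" using ev L by blast
      then have "L (j x) = c *\<^sub>R j x" using jF[OF L x(1)] by (simp add: linear_scale[OF j(1)])
      then show "L y \<in> S'"
        using y x jS c LD by (simp add: S'_def S1_def bilinear_rmul[OF bil])
    qed
    have jS': "j y \<in> S'" if y: "y \<in> S'" for y
    proof -
      have "T (j y) x = - T y (j x)"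
        using jT[of "j y" x] j(2)[of y] by (simp add: bilinear_lneg[OF bil])
      then show ?thesis using y jS jT by (simp add: S'_def S1_def)
    qed
    have "dim S' < dim S" using dim_proper_subspace[OF S S' sub(1) x(1) sub(2)] .
    from less.hyps[OF this form_on_subset[OF T sub(1)] S' F' jS'] jF sub(1) obtain B where
      B: "finite B" "0 \<notin> B" "orthogonal_for T B" "\<forall>b\<in>B. \<forall>b'\<in>B. T (j b) b' = 0"
        "span (B \<union> j ` B) = S'" "\<forall>b\<in>B. \<forall>L\<in>F. \<exists>c. L b = c *\<^sub>R b" by blast
    have BS': "b \<in> S'" if "b \<in> B" for b using that B(5) span_base by blast
    have perp: "T b x = 0 \<and> T x b = 0 \<and> T (j b) x = 0 \<and> T (j x) b = 0" if "b \<in> B" for b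
      using BS'[OF that] jS'[OF BS'[OF that]] form_onD(2)[OF T, of b x]
        form_onD(2)[OF T, of b "j x"] x(1) jS
      by (auto simp: S'_def S1_def)
    have "orthogonal_for T (insert x B)"
      using B(3) perp by (auto simp: orthogonal_for_def pairwise_insert)
    moreover have "span (insert x (insert (j x) (B \<union> j ` B))) = S"
    proof (rule span_complement_insert[OF bil S x(1)])
      have "span (insert (j x) (B \<union> j ` B)) = S1"
        using span_complement_insert[OF bil S1 jx] xx jT B(5) by (simp add: S'_def)
      then show "span (insert (j x) (B \<union> j ` B)) = {y\<in>S. T y x = 0}" by (simp add: S1_def)
    qed (use xx in simp)
    moreover have "insert x B \<union> j ` insert x B = insert x (insert (j x) (B \<union> j ` B))" by auto
    ultimately show ?thesis
      using B x ev perp jx0 by (intro exI[of _ "insert x B"]) simp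
  qed
qed

text \<open>An isomorphism is easier to write down from coordinates to the algebra, while
  \<open>lie_isomorphic_on\<close> asks for the opposite direction.\<close>

lemma lie_isomorphic_on_UNIV:
  fixes F :: "'h::real_vector \<Rightarrow> 'g::real_vector"
  assumes F: "linear F" "bij_betw F S UNIV" and S: "lie_algebra_on S br'"
    and hom: "\<And>x y. x \<in> S \<Longrightarrow> y \<in> S \<Longrightarrow> br (F x) (F y) = F (br' x y)"
  shows "lie_isomorphic_on UNIV br S br'"
proof -
  let ?f = "inv_into S F"
  have bij: "bij_betw ?f UNIV S" by (rule bij_betw_inv_into[OF F(2)])
  have fS: "?f X \<in> S" for X using bij by (auto simp: bij_betw_def)
  have Ff: "F (?f X) = X" for X by (rule bij_betw_inv_into_right[OF F(2)]) simp
  have fF: "?f X = x" if "x \<in> S" "F x = X" for x X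
    using bij_betw_inv_into_left[OF F(2) that(1)] that(2) by simp
  have sub: "subspace S" and closed: "\<And>x y. x \<in> S \<Longrightarrow> y \<in> S \<Longrightarrow> br' x y \<in> S"
    using S by (auto simp: lie_algebra_on_def)
  have "linear ?f"
  proof (rule linearI)
    show "?f (X + Y) = ?f X + ?f Y" for X Y
      using fS sub by (intro fF) (auto simp: subspace_add linear_add[OF F(1)] Ff)
    show "?f (r *\<^sub>R X) = r *\<^sub>R ?f X" for r X
      using fS sub by (intro fF) (auto simp: subspace_scale linear_scale[OF F(1)] Ff)
  qed
  moreover have "?f (br X Y) = br' (?f X) (?f Y)" for X Y
    using fS closed hom[of "?f X" "?f Y"] by (intro fF) (auto simp: Ff)
  ultimately show ?thesis using bij unfolding lie_isomorphic_on_def by blast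
qed

section \<open>The abelian ideal and the decomposition into \<open>U\<close>, \<open>W\<close> and
  \<open>J U\<close>\<close>

text \<open>The semidirect product enters through \<open>V\<close>: an abelian ideal containing all
  brackets, on which the adjoint operators commute.\<close>

locale lck_abelian_ideal =
  fixes br :: "'g::euclidean_space \<Rightarrow> 'g \<Rightarrow> 'g" and J :: "'g \<Rightarrow> 'g"
    and ip :: "'g \<Rightarrow> 'g \<Rightarrow> real" and \<theta> :: "'g \<Rightarrow> real" and V :: "'g set"
  assumes br_bilinear: "bilinear br" and br_anti: "br X Y = - br Y X"
    and V_subspace: "subspace V" and br_V: "br X Y \<in> V"
    and V_abelian: "u \<in> V \<Longrightarrow> v \<in> V \<Longrightarrow> br u v = 0"
    and V_comm: "v \<in> V \<Longrightarrow> br X (br Y v) = br Y (br X v)"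
    and V_sum: "\<exists>u\<in>V. \<exists>v\<in>V. X = u + J v"
    and lck: "lck_structure br J ip \<theta>"
    and unimodular: "unimodular br"
    and not_vaisman: "\<not> vaisman br J ip \<theta>"
    and \<theta>_nonzero: "\<theta> \<noteq> (\<lambda>_. 0)"
begin

text \<open>\<open>J\<close> carries \<open>U\<close> onto a complement of \<open>V\<close>, so the
  adjoint action of that complement can be indexed by \<open>U\<close> itself and read as a
  product.\<close>

definition act :: "'g \<Rightarrow> 'g \<Rightarrow> 'g" where "act u = br (J u)"

abbreviation lam :: "'g \<Rightarrow> real" where "lam u \<equiv> \<theta> (J u)"

definition W :: "'g set" where "W = {w\<in>V. J w \<in> V}"

definition U :: "'g set" where "U = {u\<in>V. \<forall>w\<in>W. ip u w = 0}"

lemma J_linear: "linear J" and J_J[simp]: "J (J X) = - X"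
  and nijenhuis: "br X Y - br (J X) (J Y) + J (br X (J Y)) + J (br (J X) Y) = 0"
  using lck unfolding lck_structure_def integrable_complex_structure_def by blast+

lemma ip_bilinear: "bilinear ip" and ip_sym: "ip X Y = ip Y X"
  and ip_pos: "X \<noteq> 0 \<Longrightarrow> ip X X > 0" and ip_J_J[simp]: "ip (J X) (J Y) = ip X Y"
  using lck unfolding lck_structure_def inner_product_def by blast+

lemma \<theta>_linear: "linear \<theta>" and \<theta>_br[simp]: "\<theta> (br X Y) = 0"
  using lck unfolding lck_structure_def is_lee_form_def by blast+

lemma lee:
  "- ip (J (br X Y)) Z - ip (J (br Y Z)) X - ip (J (br Z X)) Y
    = \<theta> X * ip (J Y) Z + \<theta> Y * ip (J Z) X + \<theta> Z * ip (J X) Y"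
  using lck unfolding lck_structure_def is_lee_form_def Let_def fundamental_form_def by blast

lemmas br_simps = bilinear_ladd[OF br_bilinear] bilinear_radd[OF br_bilinear]
  bilinear_lmul[OF br_bilinear] bilinear_rmul[OF br_bilinear] bilinear_lzero[OF br_bilinear]
  bilinear_rzero[OF br_bilinear] bilinear_lneg[OF br_bilinear] bilinear_rneg[OF br_bilinear]
  bilinear_lsub[OF br_bilinear] bilinear_rsub[OF br_bilinear]

lemmas ip_simps = bilinear_ladd[OF ip_bilinear] bilinear_radd[OF ip_bilinear]
  bilinear_lmul[OF ip_bilinear] bilinear_rmul[OF ip_bilinear] bilinear_lzero[OF ip_bilinear]
  bilinear_rzero[OF ip_bilinear] bilinear_lneg[OF ip_bilinear] bilinear_rneg[OF ip_bilinear]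
  bilinear_lsub[OF ip_bilinear] bilinear_rsub[OF ip_bilinear]

lemmas J_simps = linear_add[OF J_linear] linear_diff[OF J_linear] linear_neg[OF J_linear]
  linear_scale[OF J_linear] linear_0[OF J_linear]

lemmas \<theta>_simps = linear_add[OF \<theta>_linear] linear_diff[OF \<theta>_linear] linear_neg[OF \<theta>_linear]
  linear_scale[OF \<theta>_linear] linear_0[OF \<theta>_linear]

declare br_simps[simp] ip_simps[simp] J_simps[simp] \<theta>_simps[simp]

lemma act_bilinear: "bilinear act"
  unfolding bilinear_def act_def by (auto intro!: linearI)

lemmas act_simps[simp] = bilinear_ladd[OF act_bilinear] bilinear_radd[OF act_bilinear]
  bilinear_lmul[OF act_bilinear] bilinear_rmul[OF act_bilinear] bilinear_lzero[OF act_bilinear]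
  bilinear_rzero[OF act_bilinear] bilinear_lneg[OF act_bilinear] bilinear_rneg[OF act_bilinear]
  bilinear_lsub[OF act_bilinear] bilinear_rsub[OF act_bilinear]

lemma ip_J_right: "ip X (J Y) = - ip (J X) Y"
  using ip_J_J[of X "J Y"] by simp

lemma ip_J_self[simp]: "ip (J X) X = 0"
  using ip_J_right[of X X] ip_sym[of X "J X"] by simp

lemma ip_eq_0: "ip X X = 0 \<Longrightarrow> X = 0"
  using ip_pos by force

lemma ip_form: "form_on S ip"
  using ip_bilinear ip_sym ip_pos by (simp add: form_on_def)

lemma br_J_right: "br X (J u) = - act u X"
  using br_anti[of X "J u"] by (simp add: act_def)

lemma act_V: "act u v \<in> V"
  by (simp add: act_def br_V)

lemma \<theta>_act[simp]: "\<theta> (act u v) = 0"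
  by (simp add: act_def)

lemma act_comm: "v \<in> V \<Longrightarrow> act x (act y v) = act y (act x v)"
  by (simp add: act_def V_comm)

lemma W_subspace: "subspace W"
  using V_subspace by (auto simp: W_def subspace_def)

lemma U_subspace: "subspace U"
  using V_subspace by (auto simp: U_def subspace_def)

lemma W_V: "w \<in> W \<Longrightarrow> w \<in> V" and U_V: "u \<in> U \<Longrightarrow> u \<in> V"
  by (auto simp: W_def U_def)

lemma UI: "u \<in> V \<Longrightarrow> (\<And>w. w \<in> W \<Longrightarrow> ip u w = 0) \<Longrightarrow> u \<in> U"
  by (auto simp: U_def)

lemma J_W: "w \<in> W \<Longrightarrow> J w \<in> W"
  using V_subspace by (auto simp: W_def subspace_neg)

lemma U_W[simp]: "u \<in> U \<Longrightarrow> w \<in> W \<Longrightarrow> ip u w = 0" "u \<in> U \<Longrightarrow> w \<in> W \<Longrightarrow> ip w u = 0"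
  by (auto simp: U_def ip_sym)

lemma JU_W[simp]: "u \<in> U \<Longrightarrow> w \<in> W \<Longrightarrow> ip (J u) w = 0" "u \<in> U \<Longrightarrow> w \<in> W \<Longrightarrow> ip w (J u) = 0"
  using J_W[of w] ip_J_right[of u w] ip_sym[of w "J u"] by auto

lemma U_W_0: "u \<in> U \<Longrightarrow> u \<in> W \<Longrightarrow> u = 0"
  using ip_eq_0[of u] by simp

lemma V_decompose:
  assumes "v \<in> V"
  obtains u w where "u \<in> U" "w \<in> W" "v = u + w"
proof -
  obtain w where w: "w \<in> W" "\<And>x. x \<in> W \<Longrightarrow> ip v x = ip w x"
    using riesz_representation[OF ip_form W_subspace bilinear_linear(1)[OF ip_bilinear, of v]]
    by blast
  have "v - w \<in> U"
    using assms w V_subspace W_V by (auto intro!: UI simp: subspace_diff)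
  then show thesis using that[of "v - w" w] w by simp
qed

text \<open>In \<open>x + J y\<close> with \<open>x\<close> and \<open>y\<close> in
  \<open>V\<close>, the \<open>W\<close>-part of \<open>y\<close> is sent back into \<open>W\<close>
  by \<open>J\<close>, so only its \<open>U\<close>-part contributes to \<open>J U\<close>.\<close>

lemma decompose:
  obtains u w v where "u \<in> U" "w \<in> W" "v \<in> U" "X = u + w + J v"
proof -
  obtain x y where xy: "x \<in> V" "y \<in> V" "X = x + J y" using V_sum by blast
  obtain u w where u: "u \<in> U" "w \<in> W" "x = u + w" using V_decompose[OF xy(1)] .
  obtain v w' where v: "v \<in> U" "w' \<in> W" "y = v + w'" using V_decompose[OF xy(2)] .
  have "X = u + (w + J w') + J v" using xy u v by simp
  then show thesis using that[of u "w + J w'" v] u v J_W W_subspace by (simp add: subspace_add)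
qed

lemma JU_V:
  assumes "u \<in> U" "J u \<in> V"
  shows "u = 0"
  using assms U_W_0 by (auto simp: W_def U_V)

section \<open>The action of \<open>J U\<close> on \<open>W\<close> and on \<open>U\<close>\<close>

text \<open>Both \<open>w\<close> and \<open>J w\<close> commute with \<open>u\<close>, so the
  Nijenhuis identity reduces to \<open>act u\<close> commuting with \<open>J\<close> here. Then
  \<open>act u w\<close> and its \<open>J\<close>-image are both brackets, hence in
  \<open>V\<close>.\<close>

lemma act_W:
  assumes "u \<in> V" "w \<in> W"
  shows "act u w \<in> W" "act u (J w) = J (act u w)"
proof -
  have "br w u = 0" "br (J w) u = 0" using assms J_W W_V V_abelian by blast+
  then show e: "act u (J w) = J (act u w)"
    using nijenhuis[of w u] by (simp add: br_J_right)
  show "act u w \<in> W" using act_V[of u w] act_V[of u "J w"] e by (simp add: W_def)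
qed

text \<open>The Nijenhuis identity for \<open>u\<close> and \<open>v\<close>. Since
  \<open>br (J u) (J v)\<close> lies in \<open>V\<close>, so does the \<open>J\<close>-image of the
  commutator.\<close>

lemma act_commutator:
  assumes "u \<in> V" "v \<in> V"
  shows "br (J u) (J v) = J (act u v - act v u)" "act u v - act v u \<in> W"
proof -
  show e: "br (J u) (J v) = J (act u v - act v u)"
    using nijenhuis[of u v] V_abelian[OF assms] by (simp add: br_J_right act_def[symmetric] algebra_simps)
  show "act u v - act v u \<in> W"
    using act_V br_V[of "J u" "J v"] V_subspace unfolding e by (auto simp: W_def subspace_diff)
qed

text \<open>The LCK identity on \<open>J w1\<close>, \<open>w2\<close>, \<open>J u\<close>:
  orthogonality of \<open>U\<close> and \<open>W\<close> leaves only the term with \<theta> at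
  \<open>J u\<close>. So the symmetric part of \<open>act u\<close> on \<open>W\<close> is the
  scalar \<open>- lam u / 2\<close>.\<close>

lemma act_W_adjoint:
  assumes u: "u \<in> U" and w: "w1 \<in> W" "w2 \<in> W"
  shows "ip (act u w1) w2 + ip w1 (act u w2) = - lam u * ip w1 w2"
proof -
  have "br (J w1) w2 = 0" using w J_W W_V V_abelian by blast
  then show ?thesis
    using lee[of "J w1" w2 "J u"] u w J_W[OF w(1)] act_W(2)[OF U_V[OF u] w(1)]
    by (simp add: br_J_right act_def[symmetric] ip_sym[of w1])
qed

text \<open>The LCK identity on \<open>w\<close>, \<open>v\<close>, \<open>J u\<close> determines
  the \<open>W\<close>-component of \<open>act u v\<close>. It is symmetric in \<open>u\<close> and
  \<open>v\<close>, and disappears once \<open>a\<close> is known to be 0.\<close>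

lemma act_U_mod_W:
  assumes u: "u \<in> U" "v \<in> U" and a: "a \<in> W" "\<And>w. w \<in> W \<Longrightarrow> \<theta> w = ip a w"
  shows "act u v + ip u v *\<^sub>R J a \<in> U"
proof -
  have *: "ip (J (act u v)) w = ip a w * ip v u" if w: "w \<in> W" for w
  proof -
    have "br w v = 0" using w u W_V U_V V_abelian by blast
    moreover have "J (act u w) \<in> W" using act_W(1)[OF U_V[OF u(1)] w] J_W by blast
    ultimately show ?thesis
      using lee[of w v "J u"] u w a(2)[OF w] J_W[OF w]
      by (simp add: br_J_right act_def[symmetric])
  qed
  have "ip (act u v + ip u v *\<^sub>R J a) w = 0" if w: "w \<in> W" for w
    using *[OF J_W[OF w]] ip_sym[of u v] by (simp add: ip_J_right[of a w])
  then show ?thesis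
    using act_V W_V[OF J_W[OF a(1)]] V_subspace
    by (intro UI) (simp_all only: subspace_add subspace_scale)
qed

lemma \<theta>_W_vector:
  obtains a where "a \<in> W" "\<And>w. w \<in> W \<Longrightarrow> \<theta> w = ip a w"
  using riesz_representation[OF ip_form W_subspace \<theta>_linear] by blast

text \<open>The commutator lies in \<open>W\<close> by integrability, and in \<open>U\<close>
  because the \<open>W\<close>-components of the two products agree.\<close>

lemma act_sym:
  assumes "u \<in> U" "v \<in> U"
  shows "act u v = act v u"
proof -
  obtain a where a: "a \<in> W" "\<And>w. w \<in> W \<Longrightarrow> \<theta> w = ip a w" using \<theta>_W_vector by blast
  have "(act u v + ip u v *\<^sub>R J a) - (act v u + ip v u *\<^sub>R J a) \<in> U"
    using assms a act_U_mod_W U_subspace subspace_diff by blast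
  then have "act u v - act v u \<in> U" using ip_sym[of u v] by simp
  then show ?thesis using U_W_0 act_commutator(2) assms U_V by fastforce
qed

lemma br_JU_JU: "u \<in> U \<Longrightarrow> v \<in> U \<Longrightarrow> br (J u) (J v) = 0"
  using act_commutator(1) act_sym U_V by simp

section \<open>Central Lee vectors and the Lee form on \<open>V\<close>\<close>

text \<open>The adjoint map of a central vector is 0, hence skew, which would make the structure
  Vaisman. This is how the non-Vaisman hypothesis is used.\<close>

lemma no_central_lee_vector:
  assumes A: "\<And>X. \<theta> X = ip A X" and c: "\<And>X. br A X = 0"
  shows False
proof -
  have "lee_vector ip \<theta> = A" unfolding lee_vector_def
  proof (rule the_equality)
    fix A' assume "\<forall>X. \<theta> X = ip A' X"
    then have "ip (A' - A) (A' - A) = 0" using A by simp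
    then show "A' = A" using ip_eq_0 by fastforce
  qed (use A in simp)
  then show False using not_vaisman lck c by (simp add: vaisman_def)
qed

lemma central:
  assumes z: "z \<in> V" "\<And>u. u \<in> U \<Longrightarrow> act u z = 0"
  shows "br z X = 0"
proof -
  obtain u w v where X: "u \<in> U" "w \<in> W" "v \<in> U" "X = u + w + J v" using decompose .
  then show ?thesis using V_abelian z U_V W_V by (simp add: br_J_right)
qed

lemma central_J:
  assumes z: "z \<in> U" "\<And>u. u \<in> U \<Longrightarrow> act u z = 0" and W: "W = {0}"
  shows "br (J z) X = 0"
proof -
  obtain u w v where X: "u \<in> U" "w \<in> W" "v \<in> U" "X = u + w + J v" using decompose .
  have "br (J z) u = 0" using z(2)[OF X(1)] act_sym[OF z(1) X(1)] by (simp add: act_def)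
  then show ?thesis using W X z br_JU_JU by simp
qed

text \<open>All brackets inside \<open>V\<close> vanish, so the LCK identity leaves only the wedge
  product of \<theta> and \<omega>.\<close>

lemma \<theta>_VVV:
  assumes "u \<in> V" "v \<in> V" "w \<in> V"
  shows "\<theta> u * ip (J v) w + \<theta> v * ip (J w) u + \<theta> w * ip (J u) v = 0"
  using lee[of u v w] assms V_abelian by simp

lemma \<theta>_U:
  assumes "w \<in> W" "w \<noteq> 0" "u \<in> U"
  shows "\<theta> u = 0"
proof -
  have "\<theta> u * ip (J w) (J w) = 0"
    using \<theta>_VVV[of w "J w" u] assms J_W[of w] W_V[of w] W_V[of "J w"] U_V by auto
  then show ?thesis using ip_pos[OF assms(2)] by simp
qed

lemma \<theta>_W: "w \<in> W \<Longrightarrow> \<theta> w = 0"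
proof (rule ccontr)
  assume "w \<in> W" and n: "\<theta> w \<noteq> 0"
  obtain a where a: "a \<in> W" "\<And>w. w \<in> W \<Longrightarrow> \<theta> w = ip a w" using \<theta>_W_vector by blast
  have a0: "a \<noteq> 0" using n a(2)[OF \<open>w \<in> W\<close>] by auto
  have \<theta>U: "\<theta> u = 0" if "u \<in> U" for u using \<theta>_U[OF a(1) a0 that] .
  \<comment> \<open>Pair \<open>act u a\<close> with \<open>a\<close>: this is \<theta> of a
    bracket, hence 0, while the adjoint identity makes it \<open>- lam u / 2\<close> times the
    squared length of \<open>a\<close>.\<close>
  have lam0: "lam u = 0" if u: "u \<in> U" for u
  proof -
    have "ip a (act u a) = 0" using a(2)[OF act_W(1)[OF U_V[OF u] a(1)]] by simp
    then show ?thesis using act_W_adjoint[OF u a(1) a(1)] ip_pos[OF a0] ip_sym[of "act u a"] by simp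
  qed
  \<comment> \<open>Both \<open>?w\<close> and \<open>J ?w\<close> are brackets, so \<theta> kills
    them; on the triple \<open>?w\<close>, \<open>J ?w\<close>, \<open>a\<close> only \<theta> at
    \<open>a\<close> times the squared length of \<open>?w\<close> remains.\<close>
  have act0: "act u a = 0" if u: "u \<in> U" for u
  proof -
    let ?w = "act u a"
    have w: "?w \<in> W" using act_W(1)[OF U_V[OF u] a(1)] .
    have "\<theta> (J ?w) = 0"
      using \<theta>_act[of u "J a"] act_W(2)[OF U_V[OF u] a(1)] by simp
    moreover have "\<theta> ?w = 0" by simp
    ultimately have "\<theta> a * ip (J ?w) (J ?w) = 0"
      using \<theta>_VVV[of ?w "J ?w" a] w J_W[of ?w] W_V a(1) by simp
    then show ?thesis using a(2)[OF a(1)] ip_pos[OF a0] ip_eq_0[of ?w] by auto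
  qed
  show False
  proof (rule no_central_lee_vector)
    fix X
    obtain u w v where X: "u \<in> U" "w \<in> W" "v \<in> U" "X = u + w + J v" using decompose .
    show "\<theta> X = ip a X" using X a \<theta>U lam0 by simp
    show "br a X = 0" using central[OF W_V[OF a(1)]] act0 by blast
  qed
qed

section \<open>The commutative associative algebra \<open>U\<close> and its metric
  identities\<close>

lemma act_U: "u \<in> U \<Longrightarrow> v \<in> U \<Longrightarrow> act u v \<in> U"
  using act_U_mod_W[of u v 0] \<theta>_W W_subspace by (simp add: subspace_0)

text \<open>Associativity is commutativity combined with the commuting of the operators
  \<open>act x\<close> on \<open>V\<close>.\<close>

lemma act_assoc:
  assumes "u \<in> U" "v \<in> U" "x \<in> U"
  shows "act (act u v) x = act u (act v x)"
  using assms act_sym[of "act u v" x] act_sym[of v x] act_comm[of v x u] act_U U_V by simp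

text \<open>The LCK identity on \<open>v\<close>, \<open>J u\<close>, \<open>J x\<close>, the last
  two of which commute. The companion \<open>omega_act\<close> has only one argument in
  \<open>J U\<close>.\<close>

lemma ip_act_right:
  assumes "u \<in> U" "v \<in> U" "x \<in> U"
  shows "ip (act u v) x + lam u * ip v x = ip (act x v) u + lam x * ip v u + \<theta> v * ip (J u) x"
  using lee[of v "J u" "J x"] assms br_JU_JU
  by (simp add: br_J_right act_def[symmetric] ip_J_right ip_sym[of x v])

lemma omega_act:
  assumes "u \<in> U" "v \<in> U" "x \<in> U"
  shows "ip (J (act x v)) u - ip (J (act x u)) v = \<theta> u * ip v x - \<theta> v * ip u x + lam x * ip (J u) v"
  using lee[of u v "J x"] assms V_abelian[of u v] U_V
  by (simp add: br_J_right act_def[symmetric] ip_sym[of x u])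

section \<open>The case of trivial \<open>W\<close>\<close>

text \<open>\<open>act e\<close> kills \<open>J U\<close> and is a projection on the whole algebra,
  so its rank is its trace, which unimodularity makes 0.\<close>

lemma idempotent_act_zero:
  assumes W: "W = {0}" and e: "e \<in> U" "act e e = e"
  shows "act e v = 0"
proof -
  have "act e (act e X) = act e X" for X
  proof -
    obtain u w v where X: "u \<in> U" "w \<in> W" "v \<in> U" "X = u + w + J v" using decompose .
    have "act e (J v) = 0" using br_JU_JU e X by (simp add: act_def)
    then show ?thesis using X W act_assoc[OF e(1) e(1) X(1)] e(2) by simp
  qed
  then have "endo_trace (act e) = dim (range (act e))"
    by (rule idempotent_endo_trace[OF bilinear_linear(1)[OF act_bilinear]])
  moreover have "endo_trace (act e) = 0"
    using unimodular by (simp add: unimodular_def act_def)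
  ultimately show ?thesis by auto
qed

lemma act_image_subspace: "subspace S \<Longrightarrow> subspace (act u ` S)"
  by (intro linear_subspace_image bilinear_linear(1)[OF act_bilinear])

text \<open>A Fitting argument: if the rank of multiplication by \<open>c\<close> is minimal in
  \<open>S\<close>, then squaring \<open>c\<close> does not lower it, so \<open>c\<close> acts
  bijectively on its image \<open>K\<close>. This produces a unit of \<open>K\<close>, an
  idempotent, which must act as 0.\<close>

lemma squaring_closed_annihilator:
  assumes W: "W = {0}" and S: "S \<subseteq> U" "S \<noteq> {}" "\<And>c. c \<in> S \<Longrightarrow> act c c \<in> S"
  obtains c where "c \<in> S" "\<And>v. v \<in> U \<Longrightarrow> act c v = 0"
proof -
  obtain c where c: "c \<in> S" and min: "\<And>d. d \<in> S \<Longrightarrow> dim (act c ` U) \<le> dim (act d ` U)"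
    using S(2) ex_has_least_nat[of "\<lambda>c. c \<in> S" _ "\<lambda>c. dim (act c ` U)"] by blast
  have cU: "c \<in> U" using c S by blast
  define d where "d = act c c"
  define K where "K = act c ` U"
  have K: "subspace K" "K \<subseteq> U"
    using act_image_subspace U_subspace act_U cU by (auto simp: K_def)
  have dK: "d \<in> K" using cU by (simp add: d_def K_def)
  have dact: "act d x = act c (act c x)" if "x \<in> U" for x
    using act_assoc[OF cU cU that] by (simp add: d_def)
  have dU: "act d ` U = act c ` K" using dact by (auto simp: K_def image_image)
  have "act c ` K \<subseteq> K" using K(2) by (auto simp: K_def)
  moreover have "dim K \<le> dim (act d ` U)"
    using min[OF S(3)[OF c]] by (simp add: K_def d_def)
  ultimately have cK: "act c ` K = K"
    using subspace_dim_equal[OF act_image_subspace[OF K(1)] K(1)] dU by simp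
  have "act d ` K = act c ` (act c ` K)" using dact K(2)
    unfolding image_image by (intro image_cong) auto
  then have surj: "act d ` K = K" using cK by simp
  \<comment> \<open>As \<open>d\<close> itself lies in \<open>K\<close>, it has the form
    \<open>act d e\<close>. Every element of \<open>K\<close> is a multiple of \<open>d\<close>, so
    \<open>e\<close> is a unit of \<open>K\<close>.\<close>
  have "d \<in> act d ` K" unfolding surj by (rule dK)
  then obtain e where e: "d = act d e" "e \<in> K" by (rule imageE)
  have unit: "act e x = x" if "x \<in> K" for x
  proof -
    have "x \<in> act d ` K" unfolding surj by (rule that)
    then obtain y where y: "x = act d y" "y \<in> K" by (rule imageE)
    have U: "e \<in> U" "d \<in> U" "y \<in> U" using e(2) dK y(2) K(2) by blast+
    have "act e (act d y) = act (act e d) y" using act_assoc[OF U] by simp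
    also have "act e d = d" using act_sym[OF U(1,2)] e(1)[symmetric] by simp
    finally show ?thesis using y(1) by simp
  qed
  have "act e x = 0" for x using idempotent_act_zero[OF W _ unit[OF e(2)]] e(2) K(2) by blast
  then have "x = 0" if "x \<in> K" for x using unit[OF that] by simp
  then show thesis using that[OF c] by (auto simp: K_def)
qed

text \<open>Take a nonzero ideal \<open>I\<close> of minimal dimension. Each multiplication maps it
  to an ideal inside \<open>I\<close>, so to 0 or onto \<open>I\<close>. The elements acting onto
  are closed under squaring; if there were any, one of them would annihilate \<open>U\<close> and
  hence \<open>I\<close>.\<close>

lemma annihilator_exists:
  assumes W: "W = {0}"
  obtains z where "z \<in> U" "z \<noteq> 0" "\<And>u. u \<in> U \<Longrightarrow> act u z = 0"
proof -
  have "U \<noteq> {0}"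
  proof
    assume 0: "U = {0}"
    have "\<theta> X = 0" for X
    proof -
      obtain u w v where "u \<in> U" "w \<in> W" "v \<in> U" "X = u + w + J v" using decompose .
      then show ?thesis using 0 W by simp
    qed
    then show False using \<theta>_nonzero by auto
  qed
  define P where "P = (\<lambda>I. subspace I \<and> I \<subseteq> U \<and> I \<noteq> {0} \<and> (\<forall>u\<in>U. act u ` I \<subseteq> I))"
  have "P U" using \<open>U \<noteq> {0}\<close> U_subspace act_U by (auto simp: P_def)
  then obtain I where I: "P I" and min: "\<And>I'. P I' \<Longrightarrow> dim I \<le> dim I'"
    using ex_has_least_nat[of P U dim] by blast
  have IU: "i \<in> I \<Longrightarrow> i \<in> U" for i using I by (auto simp: P_def)
  have dich: "act x ` I = {0} \<or> act x ` I = I" if x: "x \<in> U" for x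
  proof (cases "act x ` I = {0}")
    case False
    have sub: "subspace (act x ` I)" "act x ` I \<subseteq> I"
      using I x act_image_subspace by (auto simp: P_def)
    have "act u (act x i) \<in> act x ` I" if "u \<in> U" "i \<in> I" for u i
      using that I act_comm[OF U_V[OF IU[OF that(2)]], of u x] by (auto simp: P_def)
    then have "P (act x ` I)" using sub False I by (auto simp: P_def)
    then have "act x ` I = I"
      using min subspace_dim_equal[OF sub(1) _ sub(2)] I by (auto simp: P_def)
    then show ?thesis ..
  qed simp
  define S where "S = {x\<in>U. act x ` I = I}"
  have "S = {}"
  proof (rule ccontr)
    assume ne: "S \<noteq> {}"
    have sub: "S \<subseteq> U" by (auto simp: S_def)
    have sq: "act c c \<in> S" if c: "c \<in> S" for c
    proof -
      have "act (act c c) ` I = act c ` (act c ` I)"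
        unfolding image_image using c act_assoc[of c c] IU by (intro image_cong) (auto simp: S_def)
      then show ?thesis using c act_U by (auto simp: S_def)
    qed
    obtain c where c: "c \<in> S" "\<And>v. v \<in> U \<Longrightarrow> act c v = 0"
      using squaring_closed_annihilator[OF W sub ne sq] by blast
    then have "act c ` I \<subseteq> {0}" using IU by auto
    then have "I \<subseteq> {0}" using c(1) by (simp add: S_def)
    then show False using I subspace_0 by (auto simp: P_def)
  qed
  then have zero: "act x i = 0" if "x \<in> U" "i \<in> I" for x i
    using dich[OF that(1)] that by (auto simp: S_def)
  have "0 \<in> I" "I \<noteq> {0}" using I subspace_0 by (auto simp: P_def)
  then obtain z where "z \<in> I" "z \<noteq> 0" by blast
  then show thesis using that zero IU by blast
qed

lemma W_nonzero: "W \<noteq> {0}"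
proof
  assume W: "W = {0}"
  obtain z where z: "z \<in> U" "z \<noteq> 0" "\<And>u. u \<in> U \<Longrightarrow> act u z = 0"
    using annihilator_exists[OF W] by blast
  have zu: "act z u = 0" if "u \<in> U" for u using act_sym[OF z(1) that] z(3)[OF that] by simp
  have N: "ip z z > 0" using ip_pos[OF z(2)] .
  \<comment> \<open>Since \<open>z\<close> annihilates \<open>U\<close>, the product terms drop out
    of \<open>omega_act\<close> and \<open>ip_act_right\<close>, and these express \<theta> on
    \<open>U\<close> and on \<open>J U\<close> as pairings with this vector.\<close>
  define A where "A = (1 / ip z z) *\<^sub>R (\<theta> z *\<^sub>R z + lam z *\<^sub>R J z)"
  show False
  proof (rule no_central_lee_vector)
    fix X
    obtain u w v where X: "u \<in> U" "w \<in> W" "v \<in> U" "X = u + w + J v" using decompose .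
    have "\<theta> u * ip z z = \<theta> z * ip z u + lam z * ip (J z) u"
      using omega_act[OF z(1) X(1) z(1)] zu[OF X(1)] zu[OF z(1)] by (simp add: ip_sym[of u z])
    then have 1: "\<theta> u = ip A u" using N by (simp add: A_def field_simps)
    have "lam v * ip z z = - \<theta> z * ip (J z) v + lam z * ip z v"
      using ip_act_right[OF z(1) z(1) X(3)] z(3)[OF X(3)] z(3)[OF z(1)] by simp
    then have 2: "lam v = ip A (J v)" using N by (simp add: A_def ip_J_right[of z] field_simps)
    show "\<theta> X = ip A X" using 1 2 X W by simp
    show "br A X = 0"
      using central[OF U_V[OF z(1)] z(3)] central_J[OF z(1,3) W] by (simp add: A_def)
  qed
qed

section \<open>The Lee form on \<open>J U\<close> and the trace form, for nonzero
  \<open>W\<close>\<close>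

lemma \<theta>_U_zero: "u \<in> U \<Longrightarrow> \<theta> u = 0"
  using W_nonzero \<theta>_U W_subspace subspace_0 by blast

lemma lam_linear: "linear lam"
  using linear_compose[OF J_linear \<theta>_linear] by (simp add: o_def)

lemma lam_vector_scalar:
  obtains h \<mu> where "h \<in> U" "h \<noteq> 0" "\<And>u. u \<in> U \<Longrightarrow> lam u = ip h u"
    "\<And>u. u \<in> U \<Longrightarrow> act h u = \<mu> *\<^sub>R u"
proof -
  obtain h where h: "h \<in> U" "\<And>u. u \<in> U \<Longrightarrow> lam u = ip h u"
    using riesz_representation[OF ip_form U_subspace lam_linear] by blast
  have h0: "h \<noteq> 0"
  proof
    assume 0: "h = 0"
    have "\<theta> X = 0" for X
    proof -
      obtain u w v where "u \<in> U" "w \<in> W" "v \<in> U" "X = u + w + J v" using decompose .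
      then show ?thesis using \<theta>_U_zero \<theta>_W h 0 by simp
    qed
    then show False using \<theta>_nonzero by auto
  qed
  have N: "ip h h > 0" using ip_pos[OF h0] .
  have E: "ip (act u v) x + lam u * ip v x = ip (act x v) u + lam x * ip v u"
    if "u \<in> U" "v \<in> U" "x \<in> U" for u v x
    using ip_act_right[OF that] \<theta>_U_zero[OF that(2)] by simp
  have hU: "act h u \<in> U" if "u \<in> U" for u using act_U h(1) that .
  \<comment> \<open>With \<open>u = h\<close> every pairing with \<open>h\<close> becomes a value of
    \<open>lam\<close>, and the resulting expression is symmetric in \<open>v\<close> and
    \<open>x\<close>.\<close>
  have hsym: "ip (act h v) x = ip v (act h x)" if v: "v \<in> U" and x: "x \<in> U" for v x
  proof -
    have "ip (act h v) x = lam (act x v) + lam x * lam v - lam h * ip v x"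
      using E[OF h(1) v x] h(2)[OF act_U[OF x v]] h(2)[OF v]
      by (simp add: ip_sym[of "act x v"] ip_sym[of v h])
    moreover have "ip (act h x) v = lam (act v x) + lam v * lam x - lam h * ip x v"
      using E[OF h(1) x v] h(2)[OF act_U[OF v x]] h(2)[OF x]
      by (simp add: ip_sym[of "act v x"] ip_sym[of x h])
    ultimately show ?thesis using act_sym[OF x v] ip_sym[of x v] ip_sym[of v "act h x"] by simp
  qed
  have skew: "ip (act u v) x - ip (act u x) v = lam x * ip u v - lam v * ip u x"
    if u: "u \<in> U" and v: "v \<in> U" and x: "x \<in> U" for u v x
    using E[OF v u x] act_sym[OF v u] act_sym[OF x u] by simp
  \<comment> \<open>\<^term>\<open>act h\<close> commutes with every \<^term>\<open>act u\<close> and, being symmetric, with its adjoint,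
    hence with the rank-two skew part of \<^term>\<open>act u\<close>.\<close>
  have comm: "lam x * ip u (act h v) - lam (act h v) * ip u x
      = lam (act h x) * ip u v - lam v * ip u (act h x)"
    if u: "u \<in> U" and v: "v \<in> U" and x: "x \<in> U" for u v x
  proof -
    have "ip (act u (act h v)) x = ip (act u v) (act h x)"
      using hsym[OF act_U[OF u v] x] act_comm[OF U_V[OF v], of u h] by simp
    moreover have "ip (act u x) (act h v) = ip (act u (act h x)) v"
      using hsym[OF act_U[OF u x] v] act_comm[OF U_V[OF x], of u h] by simp
    ultimately show ?thesis
      using skew[OF u hU[OF v] x] skew[OF u v hU[OF x]] by simp
  qed
  \<comment> \<open>The identity \<open>comm\<close> is a pairing with an arbitrary \<open>u\<close>
    in \<open>U\<close>, so nondegeneracy removes \<open>u\<close>.\<close>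
  have vec: "lam x *\<^sub>R act h v - lam (act h v) *\<^sub>R x = lam (act h x) *\<^sub>R v - lam v *\<^sub>R act h x"
    if v: "v \<in> U" and x: "x \<in> U" for v x
  proof -
    let ?y = "(lam x *\<^sub>R act h v - lam (act h v) *\<^sub>R x) - (lam (act h x) *\<^sub>R v - lam v *\<^sub>R act h x)"
    have "?y \<in> U" using U_subspace v x hU by (simp add: subspace_diff subspace_scale)
    then have "ip ?y ?y = 0" using comm[OF _ v x, of ?y] by (simp only: ip_simps) simp
    then show ?thesis using ip_eq_0 by (metis eq_iff_diff_eq_0)
  qed
  define \<mu> where "\<mu> = lam (act h h) / ip h h"
  \<comment> \<open>Taking both arguments equal to \<open>h\<close> makes \<open>h\<close> an
    eigenvector of \<open>act h\<close>; taking only the second equal to \<open>h\<close> below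
    carries its eigenvalue over to all of \<open>U\<close>.\<close>
  have "(2 * ip h h) *\<^sub>R act h h = (2 * lam (act h h)) *\<^sub>R h"
    using vec[OF h(1) h(1)] h(2)[OF h(1)] by (simp add: algebra_simps flip: scaleR_2)
  then have "ip h h *\<^sub>R act h h = lam (act h h) *\<^sub>R h"
    by (metis scaleR_scaleR scaleR_cancel_left zero_neq_numeral)
  then have "(1 / ip h h) *\<^sub>R ip h h *\<^sub>R act h h = (1 / ip h h) *\<^sub>R lam (act h h) *\<^sub>R h"
    by simp
  then have hh: "act h h = \<mu> *\<^sub>R h" using N by (simp add: \<mu>_def)
  have "act h v = \<mu> *\<^sub>R v" if v: "v \<in> U" for v
  proof -
    have "lam (act h v) = \<mu> * lam v"
      using h(2)[OF hU[OF v]] h(2)[OF v] hsym[OF h(1) v] hh by simp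
    moreover have "lam (act h h) = \<mu> * ip h h" using N by (simp add: \<mu>_def)
    ultimately have "ip h h *\<^sub>R act h v = ip h h *\<^sub>R (\<mu> *\<^sub>R v)"
      using vec[OF v h(1)] hh h(2)[OF h(1)] by (simp add: algebra_simps)
    then have "(1 / ip h h) *\<^sub>R ip h h *\<^sub>R act h v = (1 / ip h h) *\<^sub>R ip h h *\<^sub>R \<mu> *\<^sub>R v"
      by simp
    then show ?thesis using N by simp
  qed
  then show thesis using that h h0 by blast
qed

lemma dim_W_pos: "dim W > 0"
  using W_nonzero W_subspace subspace_0 by (metis dim_eq_0 gr_zeroI subset_singleton_iff empty_iff)

text \<open>The image of \<open>act u\<close> lies in \<open>V\<close>, so its trace on the algebra,
  which is 0, splits into a \<open>U\<close>-part and a \<open>W\<close>-part. By the adjoint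
  identity each orthogonal basis vector of \<open>W\<close> contributes
  \<open>- lam u / 2\<close>.\<close>

lemma act_trace:
  assumes u: "u \<in> U" and B: "independent B" "span B = U"
  shows "(\<Sum>b\<in>B. representation B (act u b) b) = lam u / 2 * dim W"
proof -
  have finB: "finite B" using B(1) independent_imp_finite by blast
  have BU: "b \<in> B \<Longrightarrow> b \<in> U" for b using B(2) span_base by blast
  obtain C where C: "finite C" "0 \<notin> C" "orthogonal_for ip C" "span C = W"
    using orthogonal_basis[OF ip_form W_subspace] .
  have CW: "c \<in> C \<Longrightarrow> c \<in> W" for c using C(4) span_base by blast
  have indC: "independent C" using orthogonal_independent[OF ip_form C(1-3) subset_UNIV] .
  have cardC: "card C = dim W" using dim_span_eq_card_independent[OF indC] C(4) by simp
  have "span B \<inter> span C \<subseteq> {0}" using U_W_0 B(2) C(4) by auto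
  note ind = independent_union[OF B(1) indC this]
  have "range (act u) \<subseteq> span (B \<union> C)"
  proof
    fix y assume "y \<in> range (act u)"
    then have "y \<in> V" using act_V by auto
    then obtain p q where "p \<in> U" "q \<in> W" "y = p + q" by (rule V_decompose)
    then show "y \<in> span (B \<union> C)" using B(2) C(4) by (auto simp: span_Un)
  qed
  then have "endo_trace (act u) = (\<Sum>b\<in>B \<union> C. representation (B \<union> C) (act u b) b)"
    using endo_trace_representation[OF bilinear_linear(1)[OF act_bilinear]] finB C(1) ind(1) by simp
  also have "\<dots> = (\<Sum>b\<in>B. representation (B \<union> C) (act u b) b)
      + (\<Sum>b\<in>C. representation (B \<union> C) (act u b) b)"
    by (rule sum.union_disjoint[OF finB C(1) ind(2)])
  also have "(\<Sum>b\<in>B. representation (B \<union> C) (act u b) b) = (\<Sum>b\<in>B. representation B (act u b) b)"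
    using representation_extend[OF ind(1), of _ B] act_U[OF u BU] B(2)
    by (intro sum.cong refl) auto
  also have "(\<Sum>b\<in>C. representation (B \<union> C) (act u b) b) = (\<Sum>b\<in>C. - lam u / 2)"
  proof (intro sum.cong refl)
    fix c assume c: "c \<in> C"
    have cW: "act u c \<in> W" using act_W(1)[OF U_V[OF u] CW[OF c]] .
    have "representation (B \<union> C) (act u c) c = representation C (act u c) c"
      using representation_extend[OF ind(1), of _ C] cW C(4) by auto
    also have "\<dots> = ip (act u c) c / ip c c"
      using orthogonal_representation[OF ip_form C c cW] .
    also have "\<dots> = - lam u / 2"
    proof -
      have "2 * ip (act u c) c = - lam u * ip c c"
        using act_W_adjoint[OF u CW[OF c] CW[OF c]] ip_sym[of c "act u c"] by simp
      moreover have "ip c c > 0" using ip_pos c C(2) by metis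
      ultimately show ?thesis by (simp add: field_simps)
    qed
    finally show "representation (B \<union> C) (act u c) c = - lam u / 2" .
  qed
  finally have "endo_trace (act u) = (\<Sum>b\<in>B. representation B (act u b) b) - lam u / 2 * dim W"
    by (simp add: cardC)
  then show ?thesis using unimodular by (simp add: unimodular_def act_def)
qed

text \<open>\<^term>\<open>lam (act u v)\<close> is up to the factor \<^term>\<open>dim W / 2\<close> the trace form of the algebra
  \<^term>\<open>U\<close>; its positivity makes the algebra a product of copies of the reals.\<close>

lemma trace_form:
  "form_on U (\<lambda>u v. lam (act u v))" "\<exists>h\<in>U. h \<noteq> 0"
proof -
  obtain h \<mu> where h: "h \<in> U" "h \<noteq> 0" "\<And>u. u \<in> U \<Longrightarrow> lam u = ip h u"
    and \<mu>: "\<And>u. u \<in> U \<Longrightarrow> act h u = \<mu> *\<^sub>R u"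
    using lam_vector_scalar by blast
  show "\<exists>h\<in>U. h \<noteq> 0" using h by blast
  have hh: "ip h h > 0" using ip_pos[OF h(2)] .
  obtain B where B: "finite B" "0 \<notin> B" "orthogonal_for ip B" "span B = U"
    using orthogonal_basis[OF ip_form U_subspace] .
  have indB: "independent B" using orthogonal_independent[OF ip_form B(1-3) subset_UNIV] .
  \<comment> \<open>Computing the trace of the scalar \<open>act h\<close> on \<open>U\<close> in
    two ways yields the sign of \<mu>.\<close>
  have "(\<Sum>b\<in>B. representation B (act h b) b) = (\<Sum>b\<in>B. \<mu>)"
  proof (intro sum.cong refl)
    fix b assume b: "b \<in> B"
    then have "b \<in> U" using B(4) span_base by blast
    then show "representation B (act h b) b = \<mu>"
      using b indB by (simp add: \<mu> representation_scale[OF indB] representation_basis span_base)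
  qed
  then have "\<mu> * card B = ip h h / 2 * dim W"
    using act_trace[OF h(1) indB B(4)] h(3)[OF h(1)] by simp
  moreover have "ip h h / 2 * dim W > 0" using hh dim_W_pos by simp
  ultimately have "\<mu> * card B > 0" by linarith
  then have \<mu>0: "\<mu> > 0" by (simp add: zero_less_mult_iff)
  have lin: "bilinear (\<lambda>u v. lam (act u v))"
    unfolding bilinear_def by (auto intro!: linearI)
  have form: "lam (act x v) = (\<mu> + ip h h) * ip v x - lam x * lam v"
    if v: "v \<in> U" and x: "x \<in> U" for v x
    using ip_act_right[OF h(1) v x] \<theta>_U_zero[OF v] \<mu>[OF v] h(3)[OF act_U[OF x v]] h(3)[OF h(1)] h(3)[OF v]
    by (simp add: ip_sym[of "act x v"] ip_sym[of v h] algebra_simps)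
  have pos: "lam (act x x) > 0" if x: "x \<in> U" "x \<noteq> 0" for x
  proof -
    \<comment> \<open>The component of \<open>x\<close> orthogonal to \<open>h\<close>, scaled to
      avoid a division; its squared length being nonnegative is the Cauchy-Schwarz
      inequality.\<close>
    let ?y = "ip h h *\<^sub>R x - lam x *\<^sub>R h"
    have "0 \<le> ip ?y ?y" using ip_pos[of ?y] by (cases "?y = 0") auto
    also have "ip ?y ?y = ip h h * (ip h h * ip x x - (lam x)\<^sup>2)"
      using h(3)[OF x(1)] by (simp add: ip_sym[of x h] algebra_simps power2_eq_square)
    finally have "(lam x)\<^sup>2 \<le> ip h h * ip x x" using hh by (simp add: zero_le_mult_iff)
    moreover have "\<mu> * ip x x > 0" using \<mu>0 ip_pos[OF x(2)] by simp
    ultimately show ?thesis using form[OF x(1) x(1)] by (simp add: algebra_simps power2_eq_square)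
  qed
  show "form_on U (\<lambda>u v. lam (act u v))"
    unfolding form_on_def using lin pos act_sym by auto
qed

section \<open>Idempotents of \<open>U\<close> and complex eigenlines of \<open>W\<close>\<close>

text \<open>Multiplications are symmetric for the trace form and commute, so they have a common
  orthogonal eigenbasis. Distinct eigenvectors multiply to 0, and each is a nonzero multiple of an
  idempotent.\<close>

lemma idempotent_basis:
  obtains B where "independent B" "span B = U" "\<And>b. b \<in> B \<Longrightarrow> act b b = b"
    "\<And>b b'. b \<in> B \<Longrightarrow> b' \<in> B \<Longrightarrow> b \<noteq> b' \<Longrightarrow> act b b' = 0"
    "\<And>b. b \<in> B \<Longrightarrow> lam b = 2 / dim W"
proof -
  define T where "T = (\<lambda>u v. lam (act u v))"
  have T: "form_on U T" using trace_form(1) by (simp add: T_def)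
  have "symmetric_family U T (act ` U)"
    unfolding symmetric_family_def
  proof (intro conjI ballI)
    fix L assume "L \<in> act ` U"
    then obtain u where u: "u \<in> U" "L = act u" by blast
    show "linear L" using u(2) bilinear_linear(1)[OF act_bilinear] by simp
    show "L x \<in> U" if "x \<in> U" for x using that u act_U by simp
    show "T (L x) y = T x (L y)" if x: "x \<in> U" and y: "y \<in> U" for x y
      using u x y act_assoc[of u x y] act_comm[OF U_V[OF y], of u x] by (simp add: T_def)
    show "L (L' x) = L' (L x)" if "L' \<in> act ` U" "x \<in> U" for L' x
      using that u act_comm[OF U_V] by auto
  qed
  from orthogonal_eigenbasis[OF T U_subspace this] obtain B0 where
    B0: "finite B0" "0 \<notin> B0" "orthogonal_for T B0" "span B0 = U"
    and ev: "\<And>b u. b \<in> B0 \<Longrightarrow> u \<in> U \<Longrightarrow> \<exists>c. act u b = c *\<^sub>R b" by auto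
  have B0U: "b \<in> B0 \<Longrightarrow> b \<in> U" for b using B0(4) span_base by blast
  have pos: "T b b > 0" if "b \<in> B0" for b using form_onD(3)[OF T B0U[OF that]] that B0(2) by blast
  have sq: "lam b *\<^sub>R act b b = T b b *\<^sub>R b" if b: "b \<in> B0" for b
  proof -
    obtain c where "act b b = c *\<^sub>R b" using ev[OF b B0U[OF b]] by blast
    then show ?thesis by (simp add: T_def)
  qed
  have lam0: "lam b \<noteq> 0" if b: "b \<in> B0" for b
    using sq[OF b] pos[OF b] b B0(2) by auto
  have prod: "act b b' = 0" if b: "b \<in> B0" "b' \<in> B0" "b \<noteq> b'" for b b'
  proof -
    obtain c where c: "act b b' = c *\<^sub>R b'" using ev[OF b(2) B0U[OF b(1)]] by blast
    have "T b b' = 0" using B0(3) b by (auto simp: orthogonal_for_def pairwise_def)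
    then have "c * lam b' = 0" using c by (simp add: T_def)
    then show ?thesis using c lam0[OF b(2)] by simp
  qed
  \<comment> \<open>By \<open>sq\<close>, \<open>b\<close> squares to \<open>T b b / lam b\<close>
    times itself; dividing by this factor gives an idempotent.\<close>
  define n where "n = (\<lambda>b. (lam b / T b b) *\<^sub>R b)"
  define B where "B = n ` B0"
  have n0: "n b \<noteq> 0" if "b \<in> B0" for b
    using that lam0[OF that] pos[OF that] B0(2) by (auto simp: n_def)
  have nn: "act (n b) (n b) = n b" if "b \<in> B0" for b
  proof -
    have "act (n b) (n b) = (lam b / (T b b * T b b)) *\<^sub>R lam b *\<^sub>R act b b" by (simp add: n_def)
    also have "\<dots> = n b" unfolding sq[OF that] using pos[OF that] by (simp add: n_def)
    finally show ?thesis .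
  qed
  have BU: "b \<in> B \<Longrightarrow> b \<in> U" for b
    using B0U U_subspace by (auto simp: B_def n_def subspace_scale)
  have idem: "act b b = b" if "b \<in> B" for b using that nn by (auto simp: B_def)
  have zero: "act b b' = 0" if bb: "b \<in> B" "b' \<in> B" "b \<noteq> b'" for b b'
  proof -
    obtain x x' where x: "x \<in> B0" "x' \<in> B0" "b = n x" "b' = n x'" using bb by (auto simp: B_def)
    then have "act x x' = 0" using prod bb(3) by blast
    then show ?thesis by (simp add: x n_def)
  qed
  have "orthogonal_for T B" using zero by (auto simp: orthogonal_for_def pairwise_def T_def)
  moreover have "finite B" "0 \<notin> B" "B \<subseteq> U" using B0(1) n0 BU by (auto simp: B_def)
  ultimately have ind: "independent B" using orthogonal_independent[OF T] by blast
  have span: "span B = U"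
  proof
    show "span B \<subseteq> U" using BU U_subspace by (intro span_minimal) auto
    have "b \<in> span B" if b: "b \<in> B0" for b
    proof -
      have "b = (T b b / lam b) *\<^sub>R n b" using lam0[OF b] pos[OF b] by (simp add: n_def)
      then show ?thesis using b by (metis B_def imageI span_base span_scale)
    qed
    then show "U \<subseteq> span B" unfolding B0(4)[symmetric] by (intro span_minimal) auto
  qed
  have "lam b = 2 / dim W" if b: "b \<in> B" for b
  proof -
    \<comment> \<open>Multiplication by \<open>b\<close> is the projection onto its own line, of
      trace 1 on \<open>U\<close>; comparison with \<open>act_trace\<close> fixes
      \<open>lam b\<close>.\<close>
    have "(\<Sum>b'\<in>B. representation B (act b b') b') = (\<Sum>b'\<in>B. if b' = b then 1 else 0)"
      using idem[OF b] zero[OF b] b ind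
      by (intro sum.cong refl) (auto simp: representation_basis representation_zero)
    also have "\<dots> = 1" using b independent_imp_finite[OF ind] by simp
    finally have "lam b * dim W = 2" using act_trace[OF BU[OF b] ind span] by simp
    moreover have "real (dim W) \<noteq> 0" using dim_W_pos by (simp del: dim_eq_0)
    ultimately show ?thesis by (simp add: eq_divide_eq)
  qed
  then show thesis using that ind span idem zero by blast
qed

lemma complex_basis:
  obtains B where "finite B" "0 \<notin> B" "orthogonal_for ip B"
    "\<And>b b'. b \<in> B \<Longrightarrow> b' \<in> B \<Longrightarrow> ip (J b) b' = 0"
    "span (B \<union> J ` B) = W" "dim W = 2 * card B"
    "\<And>b u. b \<in> B \<Longrightarrow> u \<in> U \<Longrightarrow> \<exists>m. act u b = (- lam u / 2) *\<^sub>R b + m *\<^sub>R J b"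
proof -
  \<comment> \<open>On \<^term>\<open>W\<close>, \<^term>\<open>act u\<close> is \<^term>\<open>- lam u / 2\<close> plus a skew operator commuting with \<^term>\<open>J\<close>;
    composing the latter with \<^term>\<open>J\<close> makes it symmetric.\<close>
  define K where "K = (\<lambda>u x. J (act u x + (lam u / 2) *\<^sub>R x))"
  have K_W: "K u x \<in> W" if "u \<in> U" "x \<in> W" for u x
    using that act_W(1)[OF U_V[OF that(1)] that(2)] J_W W_subspace
    by (auto simp only: K_def intro!: J_W subspace_add subspace_scale)
  have K_J: "K u (J x) = J (K u x)" if "u \<in> U" "x \<in> W" for u x
    using act_W(2)[OF U_V[OF that(1)] that(2)] by (simp add: K_def)
  have "symmetric_family W ip (K ` U)"
    unfolding symmetric_family_def
  proof (intro conjI ballI)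
    fix L assume "L \<in> K ` U"
    then obtain u where u: "u \<in> U" "L = K u" by blast
    show "linear L" unfolding u(2) K_def by (intro linearI) (simp_all add: algebra_simps)
    show "L x \<in> W" if "x \<in> W" for x using that u K_W by simp
    show "ip (L x) y = ip x (L y)" if x: "x \<in> W" and y: "y \<in> W" for x y
    proof -
      have "ip (act u x) (J y) + ip x (J (act u y)) = - lam u * ip x (J y)"
        using act_W_adjoint[OF u(1) x J_W[OF y]] act_W(2)[OF U_V[OF u(1)] y] by simp
      then show ?thesis by (simp add: u(2) K_def ip_J_right)
    qed
    show "L (L' x) = L' (L x)" if "L' \<in> K ` U" and x: "x \<in> W" for L' x
    proof -
      obtain v where v: "v \<in> U" "L' = K v" using \<open>L' \<in> K ` U\<close> by blast
      note uv = U_V[OF u(1)] U_V[OF v(1)]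
      have "act u (J (act v x)) = J (act u (act v x))" "act v (J (act u x)) = J (act v (act u x))"
        using act_W[OF _ x] act_W(2) uv by blast+
      then show ?thesis
        using act_comm[OF W_V[OF x], of u v] act_W(2)[OF uv(1) x] act_W(2)[OF uv(2) x]
        by (simp add: u(2) v(2) K_def algebra_simps)
    qed
  qed
  moreover have "L (J x) = J (L x)" if "L \<in> K ` U" "x \<in> W" for L x
    using that K_J by auto
  ultimately obtain B where B: "finite B" "0 \<notin> B" "orthogonal_for ip B"
    "\<And>b b'. b \<in> B \<Longrightarrow> b' \<in> B \<Longrightarrow> ip (J b) b' = 0" "span (B \<union> J ` B) = W"
    and ev: "\<And>b u. b \<in> B \<Longrightarrow> u \<in> U \<Longrightarrow> \<exists>c. K u b = c *\<^sub>R b"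
    using orthogonal_complex_eigenbasis[OF ip_form W_subspace _ J_linear J_J ip_J_J J_W, of "K ` U"]
    by auto
  have act: "\<exists>m. act u b = (- lam u / 2) *\<^sub>R b + m *\<^sub>R J b" if b: "b \<in> B" and u: "u \<in> U" for b u
  proof -
    obtain c where "K u b = c *\<^sub>R b" using ev b u by blast
    then have "J (K u b) = c *\<^sub>R J b" by simp
    then have "act u b = (- lam u / 2) *\<^sub>R b + (- c) *\<^sub>R J b"
      by (simp add: K_def) (metis add.commute add_diff_cancel_left' diff_conv_add_uminus minus_diff_eq uminus_add_conv_diff)
    then show ?thesis ..
  qed
  have inj: "inj_on J B" by (rule inj_onI) (metis J_J neg_equal_iff_equal)
  have disj: "B \<inter> J ` B = {}"
  proof -
    have False if "b \<in> B" "J b \<in> B" for b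
      using B(4)[OF that] ip_J_J[of b b] ip_eq_0 that(1) B(2) by fastforce
    then show ?thesis by blast
  qed
  have "orthogonal_for ip (B \<union> J ` B)"
    using B(3,4) by (auto simp: orthogonal_for_def pairwise_def ip_J_right inj_on_eq_iff[OF inj])
  moreover have "0 \<notin> B \<union> J ` B" using B(2) J_J by (metis (no_types, lifting) J_simps(5) UnE imageE neg_0_equal_iff_equal)
  ultimately have "independent (B \<union> J ` B)"
    using orthogonal_independent[OF ip_form _ _ _ subset_UNIV] B(1) by simp
  then have "dim W = card (B \<union> J ` B)"
    using dim_span_eq_card_independent B(5) by metis
  also have "\<dots> = 2 * card B"
    using card_Un_disjoint[OF B(1) _ disj] B(1) card_image[OF inj] by simp
  finally show thesis using that B act by blast
qed

section \<open>Dimensions and the identification with an OT-like algebra\<close>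

lemma dimensions:
  shows "dim V = dim U + dim W" "DIM('g) = dim V + dim U"
proof -
  have "{x + y |x y. x \<in> U \<and> y \<in> W} = V"
    using V_decompose U_V W_V V_subspace subspace_add by (blast elim: V_decompose)
  moreover have "U \<inter> W = {0}" using U_W_0 U_subspace W_subspace subspace_0 by blast
  ultimately show "dim V = dim U + dim W"
    using dim_sums_Int[OF U_subspace W_subspace] by simp
  have "X \<in> {x + y |x y. x \<in> V \<and> y \<in> J ` U}" for X
  proof -
    obtain u w v where X: "u \<in> U" "w \<in> W" "v \<in> U" "X = u + w + J v" using decompose .
    then have "u + w \<in> V" using U_V W_V V_subspace subspace_add by blast
    then show ?thesis using X by blast
  qed
  then have sum: "{x + y |x y. x \<in> V \<and> y \<in> J ` U} = UNIV" by blast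
  have sJ: "subspace (J ` U)" using linear_subspace_image[OF J_linear U_subspace] .
  have "V \<inter> J ` U = {0}"
    using JU_V V_subspace sJ subspace_0 by fastforce
  moreover have "dim (J ` U) = dim U"
    by (rule dim_image_eq[OF J_linear]) (metis J_J inj_onI neg_equal_iff_equal)
  ultimately show "DIM('g) = dim V + dim U"
    using dim_sums_Int[OF V_subspace sJ] sum by (simp add: dim_UNIV)
qed

lemma isomorphic_to_ot:
  "\<exists>t. dim W = 2 * t \<and> lck_ot_like (dim U) t br"
proof -
  obtain E where E: "independent E" "span E = U" "\<And>b. b \<in> E \<Longrightarrow> act b b = b"
    "\<And>b b'. b \<in> E \<Longrightarrow> b' \<in> E \<Longrightarrow> b \<noteq> b' \<Longrightarrow> act b b' = 0"
    "\<And>b. b \<in> E \<Longrightarrow> lam b = 2 / dim W"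
    using idempotent_basis by blast
  obtain B where B: "finite B" "0 \<notin> B" "orthogonal_for ip B"
    "\<And>b b'. b \<in> B \<Longrightarrow> b' \<in> B \<Longrightarrow> ip (J b) b' = 0"
    "span (B \<union> J ` B) = W" "dim W = 2 * card B"
    and ev: "\<And>b u. b \<in> B \<Longrightarrow> u \<in> U \<Longrightarrow> \<exists>m. act u b = (- lam u / 2) *\<^sub>R b + m *\<^sub>R J b"
    using complex_basis by blast
  define s where "s = dim U"
  define t where "t = card B"
  have sE: "s = card E" using dim_span_eq_card_independent[OF E(1)] E(2) by (simp add: s_def)
  have finE: "finite E" using E(1) independent_imp_finite by blast
  have t1: "t \<ge> 1" using dim_W_pos B(6) by (simp add: t_def)
  have s1: "s \<ge> 1" using trace_form(2) dim_eq_0[of U] unfolding s_def by fastforce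
  obtain e where e: "bij_betw e {..<s} E"
    using ex_bij_betw_nat_finite[OF finE] sE by (auto simp: atLeast0LessThan)
  obtain w where w: "bij_betw w {..<t} B"
    using ex_bij_betw_nat_finite[OF B(1)] by (auto simp: t_def atLeast0LessThan)
  have eE: "e j \<in> E" if "j < s" for j using bij_betwE[OF e] that by simp
  have wB: "w i \<in> B" if "i < t" for i using bij_betwE[OF w] that by simp
  have eU: "e j \<in> U" if "j < s" for j using eE[OF that] E(2) span_base by blast
  have wW: "w i \<in> W" if "i < t" for i
    using span_base[of "w i" "B \<union> J ` B"] wB[OF that] B(5) by simp
  have e0: "e j \<noteq> 0" if "j < s" for j using eE[OF that] E(1) dependent_zero by metis
  have ee: "act (e j) (e k) = (if j = k then e k else 0)" if "j < s" "k < s" for j k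
    using E(3,4) eE[OF that(1)] eE[OF that(2)] bij_betw_imp_inj_on[OF e] that
    by (auto dest: inj_onD)
  have lam_e: "- lam (e j) / 2 = - 1 / (2 * real t)" if "j < s" for j
    using E(5)[OF eE[OF that]] B(6) by (simp add: t_def)
  have "\<forall>i. \<forall>j. \<exists>m. i < t \<longrightarrow> j < s \<longrightarrow>
      act (e j) (w i) = (- 1 / (2 * real t)) *\<^sub>R w i + m *\<^sub>R J (w i)"
    using ev[OF wB eU] lam_e by metis
  then obtain m where m: "\<And>i j. i < t \<Longrightarrow> j < s \<Longrightarrow>
      act (e j) (w i) = (- 1 / (2 * real t)) *\<^sub>R w i + m i j *\<^sub>R J (w i)"
    by metis
  \<comment> \<open>The real part is \<open>- lam (e j) / 2\<close>, where \<open>lam (e j)\<close>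
    is 2 divided by \<open>dim W = 2 * t\<close>; the imaginary part is the rotation speed of
    \<open>act (e j)\<close> on the line of \<open>w i\<close>.\<close>
  define C where "C = (\<lambda>i j. Complex (- 1 / (2 * real t)) (m i j))"
  define H where "H = (\<lambda>a :: nat \<Rightarrow> real. \<Sum>j<s. a j *\<^sub>R e j)"
  define Z where "Z = (\<lambda>z :: nat \<Rightarrow> complex. \<Sum>i<t. Re (z i) *\<^sub>R w i + Im (z i) *\<^sub>R J (w i))"
  \<comment> \<open>The acting factor goes to \<open>J U\<close>, the real factor of the ideal to
    \<open>U\<close>, and the complex factor to \<open>W\<close> with \<open>J\<close> as the
    imaginary unit.\<close>
  define F where "F = (\<lambda>(a, b, z). J (H a) + (H b + Z z))"
  have HU: "H a \<in> U" for a
    unfolding H_def using eU U_subspace by (auto intro!: subspace_sum subspace_scale)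
  have ZW: "Z z \<in> W" for z
    unfolding Z_def using wW J_W W_subspace by (auto intro!: subspace_sum subspace_add subspace_scale)
  have Hlin: "linear H"
    by (rule linearI) (simp_all add: H_def scaleR_fun_def sum.distrib scaleR_sum_right algebra_simps)
  have Zlin: "linear Z"
    by (rule linearI) (simp_all add: Z_def scaleR_fun_def sum.distrib scaleR_sum_right algebra_simps)
  have Flin: "linear F"
    by (rule linearI) (auto simp: F_def linear_add[OF Hlin] linear_add[OF Zlin] linear_scale[OF Hlin]
        linear_scale[OF Zlin] algebra_simps)
  have He: "act (e k) (H a) = a k *\<^sub>R e k" if k: "k < s" for k a
  proof -
    have "act (e k) (H a) = (\<Sum>j<s. a j *\<^sub>R act (e k) (e j))"
      by (simp add: H_def linear_sum[OF bilinear_linear(1)[OF act_bilinear]])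
    also have "\<dots> = (\<Sum>j<s. if j = k then a k *\<^sub>R e k else 0)"
      using k by (intro sum.cong refl) (auto simp: ee)
    finally show ?thesis using k by simp
  qed
  have act_H: "act (H a) x = (\<Sum>j<s. a j *\<^sub>R act (e j) x)" for a x
    by (simp add: H_def linear_sum[OF bilinear_linear(2)[OF act_bilinear]])
  have HH: "act (H a) (H b) = H (\<lambda>j. a j * b j)" for a b
    by (simp add: act_H He) (simp add: H_def)
  have HZ: "act (H a) (Z z) = Z (\<lambda>i. (\<Sum>j<s. C i j * complex_of_real (a j)) * z i)" for a z
  proof -
    define \<kappa> where "\<kappa> = (\<lambda>i. \<Sum>j<s. C i j * complex_of_real (a j))"
    have Hw: "act (H a) (w i) = Re (\<kappa> i) *\<^sub>R w i + Im (\<kappa> i) *\<^sub>R J (w i)" if i: "i < t" for i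
    proof -
      have "act (H a) (w i) = (\<Sum>j<s. a j *\<^sub>R act (e j) (w i))"
        by (rule act_H)
      also have "\<dots> = (\<Sum>j<s. Re (C i j * complex_of_real (a j)) *\<^sub>R w i
          + Im (C i j * complex_of_real (a j)) *\<^sub>R J (w i))"
        using i by (intro sum.cong refl) (simp add: m C_def algebra_simps)
      finally show ?thesis by (simp add: \<kappa>_def sum.distrib scaleR_sum_left)
    qed
    have "act (H a) (Z z) = (\<Sum>i<t. Re (z i) *\<^sub>R act (H a) (w i) + Im (z i) *\<^sub>R act (H a) (J (w i)))"
      by (simp add: Z_def linear_sum[OF bilinear_linear(1)[OF act_bilinear]])
    also have "\<dots> = Z (\<lambda>i. \<kappa> i * z i)"
      unfolding Z_def using act_W(2)[OF U_V[OF HU] wW]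
      by (intro sum.cong refl) (simp add: Hw algebra_simps)
    finally show ?thesis by (simp add: \<kappa>_def)
  qed
  have hom: "br (F x) (F y) = F (ot_bracket s C x y)" for x y
  proof -
    obtain a b z where x: "x = (a, b, z)" by (metis prod.collapse)
    obtain a' b' z' where y: "y = (a', b', z')" by (metis prod.collapse)
    have V: "H b + Z z \<in> V" for b z
      using HU ZW U_V W_V V_subspace subspace_add by metis
    have "br (F x) (F y) = act (H a) (H b' + Z z') - act (H a') (H b + Z z)"
      using br_JU_JU[OF HU HU, of a a'] br_JU_JU[OF HU HU, of a' a] V_abelian[OF V V, of b z b' z']
      by (simp only: x y F_def split_conv br_simps br_J_right act_def[symmetric]) (simp add: algebra_simps)
    moreover have "0 = H 0" using linear_0[OF Hlin] by simp
    ultimately show ?thesis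
      by (simp add: x y F_def ot_bracket_def meta_bracket_def ot_rep_def HH HZ
          linear_diff[OF Hlin] linear_diff[OF Zlin])
  qed
  have inj: "x = 0" if x: "x \<in> ot_carrier s t" and F0: "F x = 0" for x
  proof -
    obtain a b z where abz: "x = (a, b, z)" by (metis prod.collapse)
    have sum: "J (H a) + (H b + Z z) = 0" using F0 by (simp add: F_def abz)
    then have "J (H a) = - (H b + Z z)" by (rule eq_neg_iff_add_eq_0[THEN iffD2])
    \<comment> \<open>The summands are separated in turn: \<open>J U\<close> meets \<open>V\<close>
      trivially, then \<open>U\<close> meets \<open>W\<close> trivially.\<close>
    then have "J (H a) \<in> V"
      using HU ZW U_V W_V V_subspace subspace_add subspace_neg by metis
    then have a: "H a = 0" using JU_V HU by blast
    then have "H b = - Z z" using sum by (simp add: eq_neg_iff_add_eq_0)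
    then have b: "H b = 0" using U_W_0 HU ZW W_subspace subspace_neg by metis
    have z: "Z z = 0" using sum a b by simp
    have zero: "c j = 0" if "H c = 0" "j < s" for c j using He[OF that(2), of c] that e0 by simp
    have ww: "ip (w i) (w k) = 0" if "i < t" "k < t" "i \<noteq> k" for i k
      using B(3) wB[OF that(1)] wB[OF that(2)] bij_betw_imp_inj_on[OF w] that
      by (auto simp: orthogonal_for_def pairwise_def dest: inj_onD)
    have Jww: "ip (J (w i)) (w k) = 0" if "i < t" "k < t" for i k
      using B(4) wB that by blast
    have "z k = 0" if k: "k < t" for k
    proof -
      have w0: "ip (w k) (w k) > 0" using ip_pos B(2) wB[OF k] by metis
      \<comment> \<open>Pairing with \<open>w k\<close> isolates the real part of
        \<open>z k\<close>, and pairing with \<open>J (w k)\<close> the imaginary part.\<close>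
      have "0 = ip (Z z) (w k)" using z by simp
      also have "\<dots> = (\<Sum>i<t. Re (z i) * ip (w i) (w k) + Im (z i) * ip (J (w i)) (w k))"
        by (simp add: Z_def linear_sum[OF bilinear_linear(2)[OF ip_bilinear]])
      also have "\<dots> = (\<Sum>i<t. if i = k then Re (z k) * ip (w k) (w k) else 0)"
        using k by (intro sum.cong refl) (auto simp: ww Jww)
      finally have 1: "Re (z k) = 0" using k w0 by simp
      have "0 = ip (Z z) (J (w k))" using z by simp
      also have "\<dots> = (\<Sum>i<t. Im (z i) * ip (w i) (w k) - Re (z i) * ip (J (w i)) (w k))"
        by (simp add: Z_def linear_sum[OF bilinear_linear(2)[OF ip_bilinear]])
          (simp add: ip_J_right)
      also have "\<dots> = (\<Sum>i<t. if i = k then Im (z k) * ip (w k) (w k) else 0)"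
        using k by (intro sum.cong refl) (auto simp: ww Jww)
      finally have 2: "Im (z k) = 0" using k w0 by simp
      show ?thesis using 1 2 by (simp add: complex_eq_iff)
    qed
    moreover have "a j = 0 \<and> b j = 0" if "j < s" for j using zero a b that by blast
    ultimately have "a = (\<lambda>_. 0)" "b = (\<lambda>_. 0)" "z = (\<lambda>_. 0)"
      using x by (auto simp: abz ot_carrier_def fun_eq_iff) (meson not_le_imp_less)+
    then show ?thesis by (simp add: abz zero_prod_def zero_fun_def)
  qed
  have Hsurj: "\<exists>a. (\<forall>j\<ge>s. a j = 0) \<and> u = H a" if "u \<in> U" for u
  proof -
    have "u \<in> range (\<lambda>c. \<Sum>v\<in>E. c v *\<^sub>R v)"
      using that E(2) span_finite[OF finE] by simp
    then obtain c where "u = (\<Sum>v\<in>E. c v *\<^sub>R v)" by (rule imageE)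
    also have "\<dots> = (\<Sum>j<s. c (e j) *\<^sub>R e j)"
      by (rule sum.reindex_bij_betw[OF e, symmetric])
    also have "\<dots> = H (\<lambda>j. if j < s then c (e j) else 0)" by (simp add: H_def)
    finally show ?thesis by (intro exI[of _ "\<lambda>j. if j < s then c (e j) else 0"]) simp
  qed
  have Zsurj: "\<exists>z. (\<forall>i\<ge>t. z i = 0) \<and> v = Z z" if "v \<in> W" for v
  proof -
    have injJ: "inj_on J B" by (rule inj_onI) (metis J_J neg_equal_iff_equal)
    have "v \<in> span (B \<union> J ` B)" using that B(5) by simp
    then obtain x y where "v = x + y" "x \<in> span B" "y \<in> span (J ` B)"
      by (auto simp: span_Un)
    moreover from this(2) have "x \<in> range (\<lambda>c. \<Sum>b\<in>B. c b *\<^sub>R b)"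
      by (simp only: span_finite[OF B(1)])
    then obtain c where "x = (\<Sum>b\<in>B. c b *\<^sub>R b)" by (rule imageE)
    moreover from calculation(3) have "y \<in> range (\<lambda>d. \<Sum>b\<in>J ` B. d b *\<^sub>R b)"
      by (simp only: span_finite[OF finite_imageI[OF B(1)]])
    then obtain d where "y = (\<Sum>b\<in>J ` B. d b *\<^sub>R b)" by (rule imageE)
    ultimately have "v = (\<Sum>b\<in>B. c b *\<^sub>R b) + (\<Sum>b\<in>J ` B. d b *\<^sub>R b)" by simp
    also have "(\<Sum>b\<in>J ` B. d b *\<^sub>R b) = (\<Sum>b\<in>B. d (J b) *\<^sub>R J b)"
      using sum.reindex[OF injJ] by simp
    also have "(\<Sum>b\<in>B. c b *\<^sub>R b) + (\<Sum>b\<in>B. d (J b) *\<^sub>R J b)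
        = (\<Sum>b\<in>B. c b *\<^sub>R b + d (J b) *\<^sub>R J b)"
      by (simp add: sum.distrib)
    also have "\<dots> = (\<Sum>i<t. c (w i) *\<^sub>R w i + d (J (w i)) *\<^sub>R J (w i))"
      by (rule sum.reindex_bij_betw[OF w, symmetric])
    also have "\<dots> = Z (\<lambda>i. if i < t then Complex (c (w i)) (d (J (w i))) else 0)"
      by (simp add: Z_def)
    finally show ?thesis
      by (intro exI[of _ "\<lambda>i. if i < t then Complex (c (w i)) (d (J (w i))) else 0"]) simp
  qed
  have "X \<in> F ` ot_carrier s t" for X
  proof -
    obtain u v u' where X: "u \<in> U" "v \<in> W" "u' \<in> U" "X = u + v + J u'" using decompose .
    obtain b where b: "\<forall>j\<ge>s. b j = 0" "u = H b" using Hsurj X by blast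
    obtain a where a: "\<forall>j\<ge>s. a j = 0" "u' = H a" using Hsurj X by blast
    obtain z where z: "\<forall>i\<ge>t. z i = 0" "v = Z z" using Zsurj X by blast
    have "X = F (a, b, z)" using X a b z by (simp add: F_def)
    moreover have "(a, b, z) \<in> ot_carrier s t" using a b z by (simp add: ot_carrier_def)
    ultimately show ?thesis by blast
  qed
  moreover have "inj_on F (ot_carrier s t)"
  proof (rule inj_onI)
    fix x y assume xy: "x \<in> ot_carrier s t" "y \<in> ot_carrier s t" "F x = F y"
    have "subspace (ot_carrier s t)"
      using lie_algebra_ot[of s t] by (simp add: lie_algebra_on_def)
    then have "x - y \<in> ot_carrier s t" using xy subspace_diff by blast
    moreover have "F (x - y) = 0" using xy(3) by (simp add: linear_diff[OF Flin])
    ultimately show "x = y" using inj[of "x - y"] by simp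
  qed
  ultimately have "bij_betw F (ot_carrier s t) UNIV" by (auto simp: bij_betw_def)
  then have "lie_isomorphic_on UNIV br (ot_carrier s t) (ot_bracket s C)"
    using lie_isomorphic_on_UNIV[OF Flin _ lie_algebra_ot] hom by blast
  moreover have "\<forall>i<t. \<forall>j<s. Re (C i j) = - 1 / (2 * real t)" by (simp add: C_def)
  ultimately have "lck_ot_like s t br" using s1 t1 unfolding lck_ot_like_def by blast
  then show ?thesis using B(6) by (auto simp: s_def t_def)
qed

end

section \<open>Application to the semidirect product\<close>

theorem theorem1p5:
  fixes d\<phi> :: "real ^ 'm \<Rightarrow> real ^ 'n \<Rightarrow> real ^ 'n"
    and J :: "(real ^ 'm) \<times> (real ^ 'n) \<Rightarrow> (real ^ 'm) \<times> (real ^ 'n)"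
    and ip :: "(real ^ 'm) \<times> (real ^ 'n) \<Rightarrow> (real ^ 'm) \<times> (real ^ 'n) \<Rightarrow> real"
    and \<theta> :: "(real ^ 'm) \<times> (real ^ 'n) \<Rightarrow> real"
  assumes "commuting_rep d\<phi>"
    and "unimodular (meta_bracket d\<phi>)"
    and "lck_structure (meta_bracket d\<phi>) J ip \<theta>"
    and "\<not> vaisman (meta_bracket d\<phi>) J ip \<theta>"
    and "\<theta> \<noteq> (\<lambda>_. 0)"
    and "{(0, u) + J (0, v) | u v. True} = UNIV"
  shows "\<exists>s t. CARD('m) = s \<and> CARD('n) = s + 2 * t \<and> lck_ot_like s t (meta_bracket d\<phi>)"
proof -
  define V :: "((real ^ 'm) \<times> (real ^ 'n)) set" where "V = range (Pair 0)"
  have bil: "bilinear d\<phi>" and comm: "\<And>X X' Y. d\<phi> X (d\<phi> X' Y) = d\<phi> X' (d\<phi> X Y)"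
    using assms(1) by (auto simp: commuting_rep_def fun_eq_iff)
  have Pair_linear: "linear (Pair 0 :: real ^ 'n \<Rightarrow> (real ^ 'm) \<times> (real ^ 'n))"
    by (rule linearI) simp_all
  interpret lck_abelian_ideal "meta_bracket d\<phi>" J ip \<theta> V
  proof
    show "bilinear (meta_bracket d\<phi>)" by (rule bilinear_meta_bracket[OF bil])
    show "meta_bracket d\<phi> X Y = - meta_bracket d\<phi> Y X" for X Y
      by (simp add: meta_bracket_def)
    show "subspace V"
      unfolding V_def by (rule linear_subspace_image[OF Pair_linear subspace_UNIV])
    show "meta_bracket d\<phi> X Y \<in> V" for X Y by (simp add: V_def meta_bracket_def)
    show "meta_bracket d\<phi> u v = 0" if "u \<in> V" "v \<in> V" for u v
      using that by (auto simp: V_def meta_bracket_def bilinear_lzero[OF bil] zero_prod_def)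
    show "meta_bracket d\<phi> X (meta_bracket d\<phi> Y v) = meta_bracket d\<phi> Y (meta_bracket d\<phi> X v)"
      if "v \<in> V" for v X Y
      using that comm by (auto simp: V_def meta_bracket_def bilinear_lzero[OF bil])
    show "\<exists>u\<in>V. \<exists>v\<in>V. X = u + J v" for X
    proof -
      have "X \<in> {(0, u) + J (0, v) | u v. True}" using assms(6) by simp
      then show ?thesis by (auto simp: V_def)
    qed
  qed (use assms in blast)+
  \<comment> \<open>As the total dimension is \<open>dim V + dim U\<close>, this forces the acting
    factor to have dimension \<open>dim U\<close>.\<close>
  have "dim V = CARD('n)"
    using dim_image_eq[OF Pair_linear, of UNIV] by (simp add: V_def inj_on_def dim_UNIV)
  then have "CARD('m) = dim U" "CARD('n) = dim U + dim W"
    using dimensions by simp_all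
  then show ?thesis using isomorphic_to_ot by auto
qed

end
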